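(* The Hedonic Refugees Housing problem is in $\mathsf{FPT}$ when parameterized by the combined parameter $|R|+|I|$, i.e. the number of refugees plus the number of inhabitants.
   Context: An instance of Hedonic Refugees Housing (HRH) consists of: a finite simple undirected graph $G=(V,E)$ (the topology), with $n=|V|$; a finite non-empty set $R$ of refugees and a finite set $I$ of inhabitants with $|V|\ge |R|+|I|$; an injective map $\iota\colon I\to V$; for each $h\in I$ an approval set $A_h\subseteq 2^R$; and for each $r\in R$ an approval set $A_r\subseteq 2^I$. Let $V_I=\iota(I)$ and $V_U=V\setminus V_I$. A housing is an injective map $\pi\colon R\to V_U$. It is respecting if $\{r\in R: \pi(r)\in N_G(\iota(h))\}\in A_h$ for every $h\in I$ and $\{h\in I:\iota(h)\in N_G(\pi(r))\}\in A_r$ for every $r\in R$. The question is whether a respecting housing exists. Each agent's approval set is given as an oracle that, for a given subset of agents of the opposite group, returns true iff this subset is approved; running time is measured with oracle calls as basic steps. $\mathsf{FPT}$ means solvable in $f(k)\cdot n^{\mathcal{O}(1)}$ time for some computable $f$, where $k$ is the parameter. *)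

theory Defs
  imports Main
begin

section \<open>Machine model\<close>

text \<open>
  A structured form of the unit-cost random access machine with addition and truncated
  subtraction, equipped with calls to oracles. The memory consists of arrays that are indexed by natural
  numbers, hold natural numbers, and are unbounded; a fixed program names only finitely many arrays.
  There is deliberately no unit-cost multiplication: with addition as the only growing
  operation, unit-cost time is polynomially related to Turing machine time.
\<close>

type_synonym state = "nat \<Rightarrow> nat \<Rightarrow> nat"

text \<open>Oracles are asked whether the agent with a given number approves of a given set of numbers.\<close>

type_synonym oracle_fun = "nat \<Rightarrow> nat set \<Rightarrow> bool"

datatype exp =
    Const nat
  | Cell nat exp
  | Add exp exp
  | Sub exp exp

fun eval :: "exp \<Rightarrow> state \<Rightarrow> nat" where
  "eval (Const k) s = k"
| "eval (Cell a e) s = s a (eval e s)"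
| "eval (Add e e') s = eval e s + eval e' s"
| "eval (Sub e e') s = eval e s - eval e' s"

fun cost :: "exp \<Rightarrow> nat" where
  "cost (Const k) = 1"
| "cost (Cell a e) = 1 + cost e"
| "cost (Add e e') = 1 + cost e + cost e'"
| "cost (Sub e e') = 1 + cost e + cost e'"

definition update :: "state \<Rightarrow> nat \<Rightarrow> nat \<Rightarrow> nat \<Rightarrow> state" where
  "update s a i v = s(a := (s a)(i := v))"

text \<open>
  Guards count as true iff they are nonzero. \<open>Query a i b e\<close> writes to cell \<open>i\<close> of array \<open>a\<close> the answer
  of the agent numbered \<open>e\<close> to the set whose characteristic vector is the content of array \<open>b\<close>.
  The call is a single step, but building the vector has to be paid for.
\<close>

datatype com =
    Skip
  | Assign nat exp exp
  | Query nat exp nat exp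
  | Seq com com
  | Cond exp com com
  | While exp com

text \<open>\<open>exec orc c s t s'\<close>: started in \<open>s\<close>, program \<open>c\<close> halts after exactly \<open>t\<close> steps in \<open>s'\<close>.\<close>

inductive exec :: "oracle_fun \<Rightarrow> com \<Rightarrow> state \<Rightarrow> nat \<Rightarrow> state \<Rightarrow> bool" for orc :: oracle_fun where
  Skip: "exec orc Skip s 1 s"
| Assign: "exec orc (Assign a i e) s (1 + cost i + cost e) (update s a (eval i s) (eval e s))"
| Query: "exec orc (Query a i b e) s (1 + cost i + cost e)
    (update s a (eval i s) (if orc (eval e s) {j. s b j \<noteq> 0} then 1 else 0))"
| Seq: "exec orc c s t s' \<Longrightarrow> exec orc c' s' t' s'' \<Longrightarrow> exec orc (Seq c c') s (t + t') s''"
| CondTrue: "eval e s \<noteq> 0 \<Longrightarrow> exec orc c s t s' \<Longrightarrow> exec orc (Cond e c c') s (1 + cost e + t) s'"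
| CondFalse: "eval e s = 0 \<Longrightarrow> exec orc c' s t s' \<Longrightarrow> exec orc (Cond e c c') s (1 + cost e + t) s'"
| WhileFalse: "eval e s = 0 \<Longrightarrow> exec orc (While e c) s (1 + cost e) s"
| WhileTrue: "eval e s \<noteq> 0 \<Longrightarrow> exec orc c s t s' \<Longrightarrow> exec orc (While e c) s' t' s'' \<Longrightarrow>
    exec orc (While e c) s (1 + cost e + t + t') s''"

inductive_cases exec_SkipE: "exec orc Skip s t s'"
inductive_cases exec_AssignE: "exec orc (Assign a i e) s t s'"
inductive_cases exec_QueryE: "exec orc (Query a i b e) s t s'"
inductive_cases exec_SeqE: "exec orc (Seq c c') s t s'"
inductive_cases exec_CondE: "exec orc (Cond e c c') s t s'"
inductive_cases exec_WhileE: "exec orc (While e c) s t s'"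

lemma exec_deterministic:
  "exec orc c s t s' \<Longrightarrow> exec orc c s u z \<Longrightarrow> u = t \<and> z = s'"
proof (induction arbitrary: u z rule: exec.induct)
  case (Skip s)
  from Skip.prems show ?case by (rule exec_SkipE) simp
next
  case (Assign a i e s)
  from Assign.prems show ?case by (rule exec_AssignE) simp
next
  case (Query a i b e s)
  from Query.prems show ?case by (rule exec_QueryE) simp
next
  case (Seq c s t s' c' t' s'')
  from Seq.prems show ?case
  proof (rule exec_SeqE)
    fix v r v'
    assume u: "u = v + v'" and first: "exec orc c s v r" and rest: "exec orc c' r v' z"
    from Seq.IH(1)[OF first] have "v = t" "r = s'" by simp_all
    with Seq.IH(2) rest u show ?thesis by simp
  qed
next
  case (CondTrue e s c t s' c')
  from CondTrue.prems show ?case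
    by (rule exec_CondE) (use CondTrue.hyps(1) CondTrue.IH in auto)
next
  case (CondFalse e s c' t s' c)
  from CondFalse.prems show ?case
    by (rule exec_CondE) (use CondFalse.hyps(1) CondFalse.IH in auto)
next
  case (WhileFalse e s c)
  from WhileFalse.prems show ?case
    by (rule exec_WhileE) (simp_all add: WhileFalse.hyps)
next
  case (WhileTrue e s c t s' t' s'')
  from WhileTrue.prems show ?case
    proof (rule exec_WhileE)
    assume "eval e s = 0"
    with WhileTrue.hyps(1) show ?thesis by simp
  next
    fix v r v'
    assume u: "u = Suc (cost e + v + v')" and body: "exec orc c s v r"
      and rest: "exec orc (While e c) r v' z"
    from WhileTrue.IH(1)[OF body] have "v = t" "r = s'" by simp_all
    with WhileTrue.IH(2) rest u show ?thesis by simp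
  qed
qed

text \<open>Input is read from array 0, and the result is left in its cell 0.\<close>

definition input :: "nat list \<Rightarrow> state" where
  "input w = (\<lambda>a i. if a = 0 \<and> i < length w then w ! i else 0)"

definition outputs :: "com \<Rightarrow> oracle_fun \<Rightarrow> nat list \<Rightarrow> nat \<Rightarrow> nat \<Rightarrow> bool" where
  "outputs c orc w t v \<longleftrightarrow> (\<exists>s. exec orc c (input w) t s \<and> s 0 0 = v)"

definition computable :: "(nat \<Rightarrow> nat) \<Rightarrow> bool" where
  "computable f \<longleftrightarrow> (\<exists>c. \<forall>k. \<exists>t. outputs c (\<lambda>_ _. False) [k] t (f k))"

text \<open>
  Here \<open>encodes x w orc\<close> means that the instance \<open>x\<close> may be given to an algorithm as the word \<open>w\<close>
  together with calls to \<open>orc\<close>. The program, \<open>f\<close> and \<open>d\<close> do not depend on the instance.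
\<close>

definition FPT ::
  "('x \<Rightarrow> bool) \<Rightarrow> ('x \<Rightarrow> nat list \<Rightarrow> oracle_fun \<Rightarrow> bool) \<Rightarrow> ('x \<Rightarrow> nat) \<Rightarrow> ('x \<Rightarrow> nat) \<Rightarrow> ('x \<Rightarrow> bool) \<Rightarrow> bool"
where
  "FPT is_instance encodes size_of param yes \<longleftrightarrow>
    (\<exists>c f d. computable f \<and>
      (\<forall>x w orc. is_instance x \<longrightarrow> encodes x w orc \<longrightarrow>
        (\<exists>t. outputs c orc w t (if yes x then 1 else 0) \<and> t \<le> f (param x) * size_of x ^ d)))"


section \<open>Hedonic Refugees Housing\<close>

record ('v, 'r, 'h) hrh =
  verts :: "'v set"
  edges :: "'v set set"
  refugees :: "'r set"
  inhabitants :: "'h set"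
  home :: "'h \<Rightarrow> 'v"
  inhabitant_approves :: "'h \<Rightarrow> 'r set set"
  refugee_approves :: "'r \<Rightarrow> 'h set set"

definition hrh_instance :: "('v, 'r, 'h) hrh \<Rightarrow> bool" where
  "hrh_instance x \<longleftrightarrow>
    finite (verts x) \<and>
    (\<forall>e\<in>edges x. e \<subseteq> verts x \<and> card e = 2) \<and>
    finite (refugees x) \<and> refugees x \<noteq> {} \<and>
    finite (inhabitants x) \<and>
    card (verts x) \<ge> card (refugees x) + card (inhabitants x) \<and>
    home x ` inhabitants x \<subseteq> verts x \<and> inj_on (home x) (inhabitants x) \<and>
    (\<forall>h\<in>inhabitants x. inhabitant_approves x h \<subseteq> Pow (refugees x)) \<and>
    (\<forall>r\<in>refugees x. refugee_approves x r \<subseteq> Pow (inhabitants x))"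

definition nbhd :: "('v, 'r, 'h) hrh \<Rightarrow> 'v \<Rightarrow> 'v set" where
  "nbhd x v = {u. {u, v} \<in> edges x}"

definition unoccupied :: "('v, 'r, 'h) hrh \<Rightarrow> 'v set" where
  "unoccupied x = verts x - home x ` inhabitants x"

definition housing :: "('v, 'r, 'h) hrh \<Rightarrow> ('r \<Rightarrow> 'v) \<Rightarrow> bool" where
  "housing x \<pi> \<longleftrightarrow> \<pi> ` refugees x \<subseteq> unoccupied x \<and> inj_on \<pi> (refugees x)"

definition respecting :: "('v, 'r, 'h) hrh \<Rightarrow> ('r \<Rightarrow> 'v) \<Rightarrow> bool" where
  "respecting x \<pi> \<longleftrightarrow>
    (\<forall>h\<in>inhabitants x. {r \<in> refugees x. \<pi> r \<in> nbhd x (home x h)} \<in> inhabitant_approves x h) \<and>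
    (\<forall>r\<in>refugees x. {h \<in> inhabitants x. home x h \<in> nbhd x (\<pi> r)} \<in> refugee_approves x r)"

text \<open>
  With respect to enumerations \<open>rs\<close> of the refugees and \<open>hs\<close> of the inhabitants, the refugees are the
  agents numbered from 0 on, followed by the inhabitants. In a query, the members of the opposite
  group are numbered from 0 on, and numbers out of range are ignored.
\<close>

definition approval_oracle :: "('v, 'r, 'h) hrh \<Rightarrow> 'r list \<Rightarrow> 'h list \<Rightarrow> oracle_fun" where
  "approval_oracle x rs hs a S \<longleftrightarrow>
    (if a < length rs
     then {hs ! j | j. j < length hs \<and> j \<in> S} \<in> refugee_approves x (rs ! a)
     else a < length rs + length hs \<and>
       {rs ! j | j. j < length rs \<and> j \<in> S} \<in> inhabitant_approves x (hs ! (a - length rs)))"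

text \<open>
  The word lists the three cardinalities, the positions \<open>ps\<close> in \<open>vs\<close> of the inhabitants' homes, and
  the adjacency matrix row by row. The enumerations are arbitrary, so an algorithm has to cope with
  every numbering of the vertices and agents. Approval sets are accessible through calls to \<open>orc\<close> only.
\<close>

definition hrh_encodes :: "('v, 'r, 'h) hrh \<Rightarrow> nat list \<Rightarrow> oracle_fun \<Rightarrow> bool" where
  "hrh_encodes x w orc \<longleftrightarrow>
    (\<exists>vs rs hs ps.
      distinct vs \<and> set vs = verts x \<and>
      distinct rs \<and> set rs = refugees x \<and>
      distinct hs \<and> set hs = inhabitants x \<and>
      set ps \<subseteq> {..<length vs} \<and> map ((!) vs) ps = map (home x) hs \<and>
      w = [length vs, length rs, length hs] @ ps @
          [if {u, v} \<in> edges x then 1 else 0. u \<leftarrow> vs, v \<leftarrow> vs] \<and>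
      orc = approval_oracle x rs hs)"

lemma hrh_encodes_exists:
  assumes "hrh_instance x"
  shows "\<exists>w orc. hrh_encodes x w orc"
proof -
  have fin: "finite (verts x)" "finite (refugees x)" "finite (inhabitants x)"
    and homes: "home x ` inhabitants x \<subseteq> verts x"
    using assms unfolding hrh_instance_def by simp_all
  obtain vs where vs: "set vs = verts x" "distinct vs"
    using finite_distinct_list[OF fin(1)] by blast
  obtain rs where rs: "set rs = refugees x" "distinct rs"
    using finite_distinct_list[OF fin(2)] by blast
  obtain hs where hs: "set hs = inhabitants x" "distinct hs"
    using finite_distinct_list[OF fin(3)] by blast
  have "\<exists>p. p < length vs \<and> vs ! p = home x h" if "h \<in> set hs" for h
  proof -
    have "home x h \<in> set vs"
      using homes vs(1) hs(1) that by auto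
    then show ?thesis
      by (simp add: in_set_conv_nth)
  qed
  then obtain p where p: "\<And>h. h \<in> set hs \<Longrightarrow> p h < length vs \<and> vs ! p h = home x h"
    by metis
  have "set (map p hs) \<subseteq> {..<length vs}" "map ((!) vs) (map p hs) = map (home x) hs"
    using p by auto
  with vs rs hs have "hrh_encodes x ([length vs, length rs, length hs] @ map p hs @
      [if {u, v} \<in> edges x then 1 else 0. u \<leftarrow> vs, v \<leftarrow> vs]) (approval_oracle x rs hs)"
    unfolding hrh_encodes_def
    by (intro exI[of _ vs] exI[of _ rs] exI[of _ hs] exI[of _ "map p hs"] conjI) (assumption | rule refl)+
  then show ?thesis by blast
qed

end

theory Submission
  imports Defs
begin

text \<open>
  Approvals only concern edges between a refugee and an inhabitant, so what matters about a housing
  is the set of inhabitants adjacent to each refugee. There are \<open>2 ^ (R * I)\<close> ways to guess these sets,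
  encoded as the bits of a number \<open>m\<close>: bit \<open>r * I + h\<close> says whether refugee \<open>r\<close> is adjacent to
  inhabitant \<open>h\<close>. A guess determines all answers of the oracle. Free vertices
  with the same adjacent inhabitants are interchangeable, so placing the refugees greedily decides
  whether a guess can be realised. Testing one guess takes time cubic in the number of vertices.
\<close>

section \<open>A program logic with time bounds\<close>

text \<open>Trying all housings directly would take about \<open>n ^ R\<close> attempts, with the
  parameter in the exponent of the input size. Guessing only the refugee-inhabitant adjacency matrix
  makes the number of attempts depend on \<open>R\<close> and \<open>I\<close> alone;
  \<open>R * I \<le> k * k\<close> for \<open>k = R + I\<close>, whence the bound
  \<open>2 ^ (k * k)\<close>. The price is that a guess need not come from any housing, so a test
  must prove infeasibility as well as find a realisation. All numeric constants are generous
  roundings of step counts. Since \<open>R\<close>, \<open>I\<close> are at most \<open>n\<close>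
  and \<open>n\<close> is positive (there is a refugee), every lower-order term is absorbed into a
  multiple of \<open>n * (n * n)\<close>. The program is verified against bare number properties of
  the input word; the meaning in terms of graphs and housings is attached only afterwards.\<close>

fun writes :: "com \<Rightarrow> nat set" where
  "writes Skip = {}"
| "writes (Assign a i e) = {a}"
| "writes (Query a i b e) = {a}"
| "writes (Seq c c') = writes c \<union> writes c'"
| "writes (Cond e c c') = writes c \<union> writes c'"
| "writes (While e c) = writes c"

lemma exec_frame: "exec orc c s t s' \<Longrightarrow> a \<notin> writes c \<Longrightarrow> s' a = s a"
  by (induction rule: exec.induct) (auto simp: update_def)

text \<open>Total correctness with an upper bound in place of the exact step count of
  \<open>exec\<close>. As \<open>exec\<close> is deterministic, asking for some run is asking for
  the run.\<close>

definition wp :: "oracle_fun \<Rightarrow> com \<Rightarrow> nat \<Rightarrow> (state \<Rightarrow> bool) \<Rightarrow> state \<Rightarrow> bool" where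
  "wp orc c T Q s \<longleftrightarrow> (\<exists>t s'. exec orc c s t s' \<and> t \<le> T \<and> Q s')"

text \<open>The last premise also hands over the frame facts, so postconditions and loop invariants
  need to mention only arrays that the program writes.\<close>

lemma wp_conseq:
  assumes "wp orc c T Q s" "T \<le> T'"
    and "\<And>s'. Q s' \<Longrightarrow> (\<And>a. a \<notin> writes c \<Longrightarrow> s' a = s a) \<Longrightarrow> Q' s'"
  shows "wp orc c T' Q' s"
  using assms unfolding wp_def by (meson exec_frame le_trans)

lemma wp_Skip: "Q s \<Longrightarrow> wp orc Skip 1 Q s"
  unfolding wp_def using exec.Skip by blast

lemma wp_Assign:
  "Q (update s a (eval i s) (eval e s)) \<Longrightarrow> wp orc (Assign a i e) (1 + cost i + cost e) Q s"
  unfolding wp_def using exec.Assign by blast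

lemma wp_Query:
  "Q (update s a (eval i s) (if orc (eval e s) {j. s b j \<noteq> 0} then 1 else 0)) \<Longrightarrow>
    wp orc (Query a i b e) (1 + cost i + cost e) Q s"
  unfolding wp_def using exec.Query by blast

lemma wp_Seq: "wp orc c T (wp orc c' T' Q) s \<Longrightarrow> wp orc (Seq c c') (T + T') Q s"
  unfolding wp_def by (meson add_mono exec.Seq)

text \<open>The bounds of both branches are added rather than maximised: this is simpler and costs
  only a constant factor.\<close>

lemma wp_Cond:
  assumes "eval e s \<noteq> 0 \<Longrightarrow> wp orc c T Q s" "eval e s = 0 \<Longrightarrow> wp orc c' T' Q s"
  shows "wp orc (Cond e c c') (1 + cost e + T + T') Q s"
proof (cases "eval e s = 0")
  case True
  then obtain t s' where "exec orc c' s t s'" "t \<le> T'" "Q s'"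
    using assms(2) unfolding wp_def by blast
  then show ?thesis
    unfolding wp_def using exec.CondFalse[OF True, of orc c' t s' c]
    by (intro exI[of _ "1 + cost e + t"] exI[of _ s']) simp
next
  case False
  then obtain t s' where "exec orc c s t s'" "t \<le> T" "Q s'"
    using assms(1) unfolding wp_def by blast
  then show ?thesis
    unfolding wp_def using exec.CondTrue[OF False, of orc c t s' c']
    by (intro exI[of _ "1 + cost e + t"] exI[of _ s']) simp
qed

lemma wp_While_step:
  assumes "eval e s \<noteq> 0" "wp orc c T (wp orc (While e c) T' Q) s"
  shows "wp orc (While e c) (1 + cost e + T + T') Q s"
proof -
  obtain t s' t' s'' where "exec orc c s t s'" "t \<le> T" "exec orc (While e c) s' t' s''" "t' \<le> T'" "Q s''"
    using assms(2) unfolding wp_def by blast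
  then show ?thesis
    unfolding wp_def using exec.WhileTrue[OF assms(1), of orc c t s' t' s'']
    by (intro exI[of _ "1 + cost e + t + t'"] exI[of _ s'']) simp
qed

lemma wp_While_stop: "eval e s = 0 \<Longrightarrow> Q s \<Longrightarrow> wp orc (While e c) (1 + cost e) Q s"
  unfolding wp_def using exec.WhileFalse by blast

abbreviation Var :: "nat \<Rightarrow> exp" where
  "Var a \<equiv> Cell a (Const 0)"

abbreviation Set :: "nat \<Rightarrow> exp \<Rightarrow> com" where
  "Set a e \<equiv> Assign a (Const 0) e"

text \<open>The guard is a truncated difference, hence nonzero exactly while the loop variable is
  below the bound stored in cell \<open>k\<close> of array \<open>b\<close>.\<close>

definition For :: "nat \<Rightarrow> nat \<Rightarrow> nat \<Rightarrow> com \<Rightarrow> com" where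
  "For a b k c = Seq (Set a (Const 0))
    (While (Sub (Cell b (Const k)) (Var a)) (Seq c (Set a (Add (Var a) (Const 1)))))"

lemma writes_For [simp]: "writes (For a b k c) = insert a (writes c)"
  by (simp add: For_def)

text \<open>
  \<open>P j\<close> is claimed right after the loop variable has been set to \<open>j\<close>. Per iteration the guard costs 6 steps
  and the increment 6; initialisation and the final guard cost 9.
\<close>

lemma wp_For:
  assumes "b \<noteq> a" "b \<notin> writes c" "a \<notin> writes c" "s b k = N" "N \<le> M"
    and init: "P 0 (update s a 0 0)"
    and step: "\<And>j r. j < N \<Longrightarrow> r a 0 = j \<Longrightarrow> (\<And>x. x \<noteq> a \<Longrightarrow> x \<notin> writes c \<Longrightarrow> r x = s x) \<Longrightarrow>
      P j r \<Longrightarrow> wp orc c T (\<lambda>r'. P (Suc j) (update r' a 0 (Suc j))) r"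
  shows "wp orc (For a b k c) (M * (T + 12) + 9) (P N) s"
proof -
  let ?e = "Sub (Cell b (Const k)) (Var a)"
  let ?c = "Seq c (Set a (Add (Var a) (Const 1)))"
  \<comment> \<open>\<open>d\<close> counts the remaining iterations. The last premise keeps
    \<open>r\<close> tied to the initial state \<open>s\<close> outside the arrays touched by the
    loop, so the bound in \<open>b\<close> stays \<open>N\<close>.\<close>
  have loop: "wp orc (While ?e ?c) (d * (T + 12) + 6) (P N) r"
    if "d + j = N" "r a 0 = j" "P j r" "\<And>x. x \<noteq> a \<Longrightarrow> x \<notin> writes c \<Longrightarrow> r x = s x" for d j r
    using that
  proof (induction d arbitrary: j r)
    case 0
    have "wp orc (While ?e ?c) (1 + cost ?e) (P N) r"
      using 0 assms(1,2,4) by (intro wp_While_stop) auto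
    then show ?case by (rule wp_conseq) auto
  next
    case (Suc d)
    have "wp orc (While ?e ?c) (1 + cost ?e + (T + (1 + cost (Const 0) + cost (Add (Var a) (Const 1)))) +
        (d * (T + 12) + 6)) (P N) r"
    proof (rule wp_While_step)
      show "eval ?e r \<noteq> 0" using Suc.prems assms(1,2,4) by auto
      show "wp orc ?c (T + (1 + cost (Const 0) + cost (Add (Var a) (Const 1))))
          (wp orc (While ?e ?c) (d * (T + 12) + 6) (P N)) r"
      proof (rule wp_Seq, rule wp_conseq[OF step[of j r] order_refl])
        fix r'
        assume r': "P (Suc j) (update r' a 0 (Suc j))" "\<And>x. x \<notin> writes c \<Longrightarrow> r' x = r x"
        then have *: "r' a 0 = j" using Suc.prems assms(3) by auto
        show "wp orc (Set a (Add (Var a) (Const 1))) (1 + cost (Const 0) + cost (Add (Var a) (Const 1)))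
            (wp orc (While ?e ?c) (d * (T + 12) + 6) (P N)) r'"
        proof (rule wp_Assign, rule Suc.IH[of "Suc j"])
          have "update r' a (eval (Const 0) r') (eval (Add (Var a) (Const 1)) r') = update r' a 0 (Suc j)"
            using * by simp
          then show "P (Suc j) (update r' a (eval (Const 0) r') (eval (Add (Var a) (Const 1)) r'))"
            using r'(1) by (simp only:)
        qed (use r' * Suc.prems in \<open>auto simp: update_def\<close>)
      qed (use Suc.prems in auto)
    qed
    then show ?case by (rule wp_conseq) auto
  qed
  have "wp orc (For a b k c) ((1 + cost (Const 0) + cost (Const 0)) + (N * (T + 12) + 6)) (P N) s"
    unfolding For_def using assms(1,4) init
    by (intro wp_Seq wp_Assign loop[where j = 0]) (auto simp: update_def)
  \<comment> \<open>\<open>M\<close> lets callers state times in terms of \<open>n\<close> although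
    the loop runs \<open>R\<close> or \<open>I\<close> times.\<close>
  moreover have "N * (T + 12) \<le> M * (T + 12)"
    using assms(5) by (rule mult_right_mono) simp
  ultimately show ?thesis by (elim wp_conseq) auto
qed

lemma wp_SeqI:
  assumes "wp orc c T P s"
    and "\<And>s'. P s' \<Longrightarrow> (\<And>a. a \<notin> writes c \<Longrightarrow> s' a = s a) \<Longrightarrow> wp orc c' T' Q s'"
    and "T + T' \<le> U"
  shows "wp orc (Seq c c') U Q s"
proof -
  have "wp orc c T (wp orc c' T' Q) s"
    by (rule wp_conseq[OF assms(1) order_refl assms(2)])
  from wp_Seq[OF this] show ?thesis
    by (rule wp_conseq) (rule assms(3))
qed

lemma wp_le: "wp orc c T Q s \<Longrightarrow> T \<le> T' \<Longrightarrow> wp orc c T' Q s"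
  by (rule wp_conseq)

section \<open>The algorithm\<close>

text \<open>
  Array \<open>bits\<close> holds the binary digits of the guess and \<open>query\<close> the set passed to the oracle;
  \<open>used\<close> marks vertices that are occupied by an inhabitant or an already placed refugee. Multiplication is
  avoided by tabulating the offsets \<open>row r = r * I\<close> into \<open>bits\<close> and \<open>base v = 3 + I + v * n\<close> into
  the input. The number 1 is skipped because the simplifier rewrites it to \<open>Suc 0\<close>.
  The arrays named with a leading \<open>v\<close> only use cell 0.
\<close>

abbreviation (input) "bits \<equiv> 2 :: nat"
abbreviation (input) "query \<equiv> 3 :: nat"
abbreviation (input) "used \<equiv> 4 :: nat"
abbreviation (input) "row \<equiv> 5 :: nat"
abbreviation (input) "base \<equiv> 6 :: nat"
abbreviation (input) "vr \<equiv> 7 :: nat"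
abbreviation (input) "vh \<equiv> 8 :: nat"
abbreviation (input) "vv \<equiv> 9 :: nat"
abbreviation (input) "vok \<equiv> 10 :: nat"
abbreviation (input) "vplaced \<equiv> 11 :: nat"
abbreviation (input) "vmatch \<equiv> 12 :: nat"
abbreviation (input) "vfound \<equiv> 13 :: nat"
abbreviation (input) "vlen \<equiv> 14 :: nat"
abbreviation (input) "vpow \<equiv> 15 :: nat"
abbreviation (input) "vm \<equiv> 16 :: nat"
abbreviation (input) "vj \<equiv> 17 :: nat"
abbreviation (input) "vcarry \<equiv> 18 :: nat"

definition guessed :: exp where
  "guessed = Cell bits (Add (Cell row (Var vr)) (Var vh))"

text \<open>The inner read of the input yields the position of the home of inhabitant
  \<open>vh\<close>; the outer one is the adjacency matrix entry in row \<open>vv\<close> and that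
  column.\<close>

definition adjacent :: exp where
  "adjacent = Cell 0 (Add (Cell base (Var vv)) (Cell 0 (Add (Const 3) (Var vh))))"

text \<open>\<open>Query\<close> overwrites \<open>vok\<close>, so the guard on \<open>vok\<close>
  prevents a later approval from erasing an earlier refusal.\<close>

definition check_rows :: com where
  "check_rows = For vr 0 1 (Seq (For vh 0 2 (Assign query (Var vh) guessed))
    (Cond (Var vok) (Query vok (Const 0) query (Var vr)) Skip))"

definition check_cols :: com where
  "check_cols = For vh 0 2 (Seq (For vr 0 1 (Assign query (Var vr) guessed))
    (Cond (Var vok) (Query vok (Const 0) query (Add (Cell 0 (Const 1)) (Var vh))) Skip))"

definition mark_homes :: com where
  "mark_homes = Seq (For vv 0 0 (Assign used (Var vv) (Const 0)))
    (For vh 0 2 (Assign used (Cell 0 (Add (Const 3) (Var vh))) (Const 1)))"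

text \<open>Of two truncated differences in opposite directions at least one is nonzero iff the two
  values differ.\<close>

definition match_type :: com where
  "match_type = Seq (Set vmatch (Const 1))
    (For vh 0 2 (Cond (Add (Sub guessed adjacent) (Sub adjacent guessed)) (Set vmatch (Const 0)) Skip))"

text \<open>\<open>For\<close> has no early exit; once \<open>vplaced\<close> is set, the remaining
  iterations do nothing.\<close>

definition place_one :: com where
  "place_one = Seq (Set vplaced (Const 0))
    (For vv 0 0 (Cond (Add (Var vplaced) (Cell used (Var vv))) Skip
      (Seq match_type
        (Cond (Var vmatch) (Seq (Assign used (Var vv) (Const 1)) (Set vplaced (Const 1))) Skip))))"

definition place_all :: com where
  "place_all = Seq mark_homes (For vr 0 1 (Seq place_one (Cond (Var vplaced) Skip (Set vok (Const 0)))))"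

definition check :: com where
  "check = Seq (Set vok (Const 1)) (Seq check_rows (Seq check_cols place_all))"

definition increment :: com where
  "increment = Seq (Set vcarry (Const 1))
    (For vj vlen 0 (Cond (Var vcarry)
      (Cond (Cell bits (Var vj)) (Assign bits (Var vj) (Const 0))
        (Seq (Assign bits (Var vj) (Const 1)) (Set vcarry (Const 0)))) Skip))"

definition search :: com where
  "search = For vm vpow 0 (Seq check (Seq (Cond (Var vok) (Set vfound (Const 1)) Skip) increment))"

definition setup_rows :: com where
  "setup_rows = For vr 0 1 (Assign row (Add (Var vr) (Const 1)) (Add (Cell row (Var vr)) (Cell 0 (Const 2))))"

definition setup_base :: com where
  "setup_base = Seq (Assign base (Const 0) (Add (Const 3) (Cell 0 (Const 2))))
    (For vv 0 0 (Assign base (Add (Var vv) (Const 1)) (Add (Cell base (Var vv)) (Cell 0 (Const 0)))))"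

text \<open>\<open>row R\<close> holds \<open>R * I\<close>, the number of bits of a guess. Doubling
  that many times replaces exponentiation.\<close>

definition setup_pow :: com where
  "setup_pow = Seq (Set vlen (Cell row (Cell 0 (Const 1))))
    (Seq (Set vpow (Const 1)) (For vj vlen 0 (Set vpow (Add (Var vpow) (Var vpow)))))"

definition solve :: com where
  "solve = Seq setup_rows (Seq setup_base (Seq setup_pow (Seq search
    (Cond (Var vfound) (Set 0 (Const 1)) (Set 0 (Const 0))))))"

text \<open>The carry of the binary increment of \<open>m\<close> reaches position \<open>j\<close> iff \<open>2 ^ j dvd Suc m\<close>.\<close>

lemma dvd_power_Suc_iff_bit: "2 ^ Suc j dvd Suc m \<longleftrightarrow> 2 ^ j dvd Suc m \<and> bit m j"
proof (cases "2 ^ j dvd Suc m")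
  case True
  then have "Suc m div 2 ^ j = Suc (m div 2 ^ j)" by (simp add: div_Suc)
  moreover have "2 ^ Suc j dvd Suc m \<longleftrightarrow> 2 dvd Suc m div 2 ^ j"
    using dvd_div_iff_mult[OF _ True, of 2] by (simp add: mult.commute)
  ultimately show ?thesis using True by (simp add: bit_iff_odd)
next
  case False
  then show ?thesis using dvd_mult_right[of 2 "2 ^ j" "Suc m"] by auto
qed

text \<open>Passing from \<open>m\<close> to \<open>Suc m\<close> raises the quotient by
  \<open>2 ^ j\<close> by one, and so flips its parity, exactly when \<open>2 ^ j\<close> divides
  \<open>Suc m\<close>.\<close>

lemma bit_Suc_iff_dvd: "bit (Suc m) j \<longleftrightarrow> bit m j \<noteq> (2 ^ j dvd Suc m)"
  by (simp add: bit_iff_odd div_Suc mod_eq_0_iff_dvd)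

lemma index_less:
  fixes r h R I :: nat
  assumes "r < R" "h < I"
  shows "r * I + h < R * I"
proof -
  have "r * I + h < Suc r * I" using assms(2) by simp
  also have "\<dots> \<le> R * I" using assms(1) by (intro mult_right_mono) auto
  finally show ?thesis .
qed

section \<open>Correctness of the algorithm\<close>

text \<open>Everything the program proof knows about the instance. \<open>adj_le\<close> makes
  matrix entries comparable with guessed bits; \<open>orc_row\<close> and \<open>orc_col\<close> say
  that numbers out of range are ignored in queries.\<close>

locale hrh_word =
  fixes orc :: oracle_fun and A :: "nat \<Rightarrow> nat" and n R I :: nat
  assumes A0: "A 0 = n" and A1: "A (Suc 0) = R" and A2: "A 2 = I"
    and R_le: "R \<le> n" and I_le: "I \<le> n" and n_pos: "0 < n"
    and home_less: "h < I \<Longrightarrow> A (3 + h) < n"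
    and adj_le: "v < n \<Longrightarrow> h < I \<Longrightarrow> A (3 + I + v * n + A (3 + h)) \<le> 1"
    and orc_row: "r < R \<Longrightarrow> orc r S = orc r {j \<in> S. j < I}"
    and orc_col: "h < I \<Longrightarrow> orc (R + h) S = orc (R + h) {j \<in> S. j < R}"
begin

text \<open>\<open>ty v\<close> is the set of inhabitants adjacent to vertex \<open>v\<close>, read off the input word.\<close>

definition ty :: "nat \<Rightarrow> nat set" where
  "ty v = {h. h < I \<and> A (3 + I + v * n + A (3 + h)) \<noteq> 0}"

definition rw :: "nat \<Rightarrow> nat \<Rightarrow> nat set" where
  "rw m r = {h. h < I \<and> bit m (r * I + h)}"

definition col :: "nat \<Rightarrow> nat \<Rightarrow> nat set" where
  "col m h = {r. r < R \<and> bit m (r * I + h)}"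

definition homes :: "nat set" where
  "homes = (\<lambda>h. A (3 + h)) ` {..<I}"

text \<open>Prefixes \<open>k\<close> of the refugees are allowed because this serves as the
  invariant of the greedy loop.\<close>

definition placement :: "nat \<Rightarrow> nat \<Rightarrow> (nat \<Rightarrow> nat) \<Rightarrow> bool" where
  "placement m k \<pi> \<longleftrightarrow> inj_on \<pi> {..<k} \<and> (\<forall>r<k. \<pi> r < n \<and> \<pi> r \<notin> homes \<and> ty (\<pi> r) = rw m r)"

definition good :: "nat \<Rightarrow> bool" where
  "good m \<longleftrightarrow> (\<forall>r<R. orc r (rw m r)) \<and> (\<forall>h<I. orc (R + h) (col m h)) \<and> (\<exists>\<pi>. placement m R \<pi>)"

text \<open>The data that testing the guess \<open>m\<close> relies on. During the search only
  \<open>bits\<close> changes among these arrays, and only in \<open>increment\<close>.\<close>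

definition env :: "nat \<Rightarrow> state \<Rightarrow> bool" where
  "env m s \<longleftrightarrow> s 0 = A \<and> (\<forall>r\<le>R. s row r = r * I) \<and> (\<forall>v\<le>n. s base v = 3 + I + v * n) \<and>
    (\<forall>j<R*I. s bits j = of_bool (bit m j))"

lemma env_cong:
  "env m s \<Longrightarrow> s' 0 = s 0 \<Longrightarrow> s' row = s row \<Longrightarrow> s' base = s base \<Longrightarrow> s' bits = s bits \<Longrightarrow> env m s'"
  by (simp add: env_def)

lemma eval_guessed:
  "env m s \<Longrightarrow> s vr 0 < R \<Longrightarrow> s vh 0 < I \<Longrightarrow> eval guessed s = of_bool (bit m (s vr 0 * I + s vh 0))"
  using index_less by (simp add: guessed_def env_def)

lemma eval_adjacent:
  "env m s \<Longrightarrow> s vv 0 < n \<Longrightarrow> s vh 0 < I \<Longrightarrow> eval adjacent s = of_bool (s vh 0 \<in> ty (s vv 0))"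
  using adj_le[of "s vv 0" "s vh 0"] by (auto simp: adjacent_def env_def ty_def)

text \<open>Absorbs a nested loop: 12 is the overhead per iteration, and the final 12 is the 9 steps
  of \<open>For\<close> plus 3 for an initialising assignment.\<close>

lemma loop_time: "a + 24 \<le> b \<Longrightarrow> n * (a * n + 12) + 12 \<le> b * (n * n)"
proof -
  assume "a + 24 \<le> b"
  then have "(a + 24) * (n * n) \<le> b * (n * n)" by (rule mult_right_mono) simp
  moreover have "n \<le> n * n" by simp
  moreover have "1 \<le> n * n" using n_pos by (simp add: Suc_leI)
  ultimately show ?thesis unfolding distrib_right distrib_left mult.left_commute[of n a] by linarith
qed

lemma powers_le: "1 \<le> n * (n * n)" "n \<le> n * (n * n)" "n * n \<le> n * (n * n)"
  using n_pos by (simp_all add: Suc_leI)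

section \<open>Testing the guess against the approval sets\<close>

lemma wp_check_rows:
  assumes env: "env m s"
  shows "wp orc check_rows (74 * (n * n))
    (\<lambda>s'. s' vok 0 \<noteq> 0 \<longleftrightarrow> s vok 0 \<noteq> 0 \<and> (\<forall>r<R. orc r (rw m r))) s"
proof -
  have bounds: "s 0 0 = n" "s 0 (Suc 0) = R" "s 0 2 = I"
    using env A0 A1 A2 by (simp_all add: env_def)
  have copy: "wp orc (For vh 0 2 (Assign query (Var vh) guessed)) (40 * n)
      (\<lambda>s'. {j. s' query j \<noteq> 0 \<and> j < I} = rw m (s' vr 0)) s1"
    if s1: "env m s1" "s1 vr 0 < R" for s1
  proof -
    have I: "s1 0 2 = I" using s1 A2 by (simp add: env_def)
    show ?thesis
    proof (rule wp_conseq[OF wp_For[where T = 11 and M = n and N = I and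
          P = "\<lambda>j s'. \<forall>h<j. s' query h = of_bool (bit m (s1 vr 0 * I + h))"]])
      fix j s'
      assume *: "j < I" "s' vh 0 = j" "\<And>x. x \<noteq> vh \<Longrightarrow> x \<notin> writes (Assign query (Var vh) guessed) \<Longrightarrow> s' x = s1 x"
        "\<forall>h<j. s' query h = of_bool (bit m (s1 vr 0 * I + h))"
      have "env m s'" by (rule env_cong[OF s1(1)]) (simp_all add: *)
      then have g: "eval guessed s' = of_bool (bit m (s1 vr 0 * I + j))"
        using eval_guessed[of m s'] * s1 I by simp
      show "wp orc (Assign query (Var vh) guessed) 11
        (\<lambda>s'. \<forall>h<Suc j. update s' vh 0 (Suc j) query h = of_bool (bit m (s1 vr 0 * I + h))) s'"
        by (rule wp_le, rule wp_Assign) (use * g in \<open>auto simp: update_def less_Suc_eq guessed_def\<close>)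
    qed (use I I_le n_pos in \<open>auto simp: rw_def\<close>)
  qed
  show ?thesis
    unfolding check_rows_def
  proof (rule wp_conseq[OF wp_For[where T = "50 * n" and M = n and N = R and
          P = "\<lambda>j s'. s' vok 0 \<noteq> 0 \<longleftrightarrow> s vok 0 \<noteq> 0 \<and> (\<forall>r<j. orc r (rw m r))"]])
    fix j s1
    let ?c = "Seq (For vh 0 2 (Assign query (Var vh) guessed))
        (Cond (Var vok) (Query vok (Const 0) query (Var vr)) Skip)"
    assume *: "j < R" "s1 vr 0 = j" "\<And>x. x \<noteq> vr \<Longrightarrow> x \<notin> writes ?c \<Longrightarrow> s1 x = s x"
      "s1 vok 0 \<noteq> 0 \<longleftrightarrow> s vok 0 \<noteq> 0 \<and> (\<forall>r<j. orc r (rw m r))"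
    have env1: "env m s1" by (rule env_cong[OF env]) (simp_all add: *)
    have j: "j < R" using *(1) bounds by simp
    show "wp orc ?c (50 * n)
      (\<lambda>s'. update s' vr 0 (Suc j) vok 0 \<noteq> 0 \<longleftrightarrow> s vok 0 \<noteq> 0 \<and> (\<forall>r<Suc j. orc r (rw m r))) s1"
    proof (rule wp_le, rule wp_Seq, rule wp_conseq[OF copy order_refl])
      fix s2
      assume s2: "{j. s2 query j \<noteq> 0 \<and> j < I} = rw m (s2 vr 0)"
        "\<And>a. a \<notin> writes (For vh 0 2 (Assign query (Var vh) guessed)) \<Longrightarrow> s2 a = s1 a"
      \<comment> \<open>\<open>query\<close> is never cleared, so entries left over from
        \<open>check_cols\<close> may survive at positions from \<open>I\<close> on;
        \<open>orc_row\<close> makes them harmless.\<close>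
      have q: "orc j {j. s2 query j \<noteq> 0} = orc j (rw m j)"
        using orc_row[OF j, of "{j. s2 query j \<noteq> 0}"] s2 *(2) by simp
      show "wp orc (Cond (Var vok) (Query vok (Const 0) query (Var vr)) Skip) 9
        (\<lambda>s'. update s' vr 0 (Suc j) vok 0 \<noteq> 0 \<longleftrightarrow> s vok 0 \<noteq> 0 \<and> (\<forall>r<Suc j. orc r (rw m r))) s2"
        by (rule wp_le, rule wp_Cond, rule wp_Query, rule_tac [2] wp_Skip)
          (use q s2(2) * in \<open>auto simp: update_def less_Suc_eq\<close>)
    qed (use env1 j *(2) n_pos in auto)
  qed (use bounds R_le loop_time[of 50 74] in \<open>auto simp: update_def\<close>)
qed

lemma wp_check_cols:
  assumes env: "env m s"
  shows "wp orc check_cols (84 * (n * n))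
    (\<lambda>s'. s' vok 0 \<noteq> 0 \<longleftrightarrow> s vok 0 \<noteq> 0 \<and> (\<forall>h<I. orc (R + h) (col m h))) s"
proof -
  have bounds: "s 0 0 = n" "s 0 (Suc 0) = R" "s 0 2 = I"
    using env A0 A1 A2 by (simp_all add: env_def)
  have copy: "wp orc (For vr 0 1 (Assign query (Var vr) guessed)) (40 * n)
      (\<lambda>s'. {j. s' query j \<noteq> 0 \<and> j < R} = col m (s' vh 0)) s1"
    if s1: "env m s1" "s1 vh 0 < I" for s1
  proof -
    have R: "s1 0 (Suc 0) = R" using s1 A1 by (simp add: env_def)
    show ?thesis
    proof (rule wp_conseq[OF wp_For[where T = 11 and M = n and N = R and
          P = "\<lambda>j s'. \<forall>r<j. s' query r = of_bool (bit m (r * I + s1 vh 0))"]])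
      fix j s'
      assume *: "j < R" "s' vr 0 = j" "\<And>x. x \<noteq> vr \<Longrightarrow> x \<notin> writes (Assign query (Var vr) guessed) \<Longrightarrow> s' x = s1 x"
        "\<forall>r<j. s' query r = of_bool (bit m (r * I + s1 vh 0))"
      have "env m s'" by (rule env_cong[OF s1(1)]) (simp_all add: *)
      then have g: "eval guessed s' = of_bool (bit m (j * I + s1 vh 0))"
        using eval_guessed[of m s'] * s1 R by simp
      show "wp orc (Assign query (Var vr) guessed) 11
        (\<lambda>s'. \<forall>r<Suc j. update s' vr 0 (Suc j) query r = of_bool (bit m (r * I + s1 vh 0))) s'"
        by (rule wp_le, rule wp_Assign) (use * g in \<open>auto simp: update_def less_Suc_eq guessed_def\<close>)
    qed (use R R_le n_pos in \<open>auto simp: col_def\<close>)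
  qed
  show ?thesis
    unfolding check_cols_def
  proof (rule wp_conseq[OF wp_For[where T = "60 * n" and M = n and N = I and
          P = "\<lambda>j s'. s' vok 0 \<noteq> 0 \<longleftrightarrow> s vok 0 \<noteq> 0 \<and> (\<forall>h<j. orc (R + h) (col m h))"]])
    fix j s1
    let ?c = "Seq (For vr 0 1 (Assign query (Var vr) guessed))
        (Cond (Var vok) (Query vok (Const 0) query (Add (Cell 0 (Const 1)) (Var vh))) Skip)"
    assume *: "j < I" "s1 vh 0 = j" "\<And>x. x \<noteq> vh \<Longrightarrow> x \<notin> writes ?c \<Longrightarrow> s1 x = s x"
      "s1 vok 0 \<noteq> 0 \<longleftrightarrow> s vok 0 \<noteq> 0 \<and> (\<forall>h<j. orc (R + h) (col m h))"
    have env1: "env m s1" by (rule env_cong[OF env]) (simp_all add: *)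
    have j: "j < I" using *(1) bounds by simp
    show "wp orc ?c (60 * n)
      (\<lambda>s'. update s' vh 0 (Suc j) vok 0 \<noteq> 0 \<longleftrightarrow> s vok 0 \<noteq> 0 \<and> (\<forall>h<Suc j. orc (R + h) (col m h))) s1"
    proof (rule wp_le, rule wp_Seq, rule wp_conseq[OF copy order_refl])
      fix s2
      assume s2: "{j. s2 query j \<noteq> 0 \<and> j < R} = col m (s2 vh 0)"
        "\<And>a. a \<notin> writes (For vr 0 1 (Assign query (Var vr) guessed)) \<Longrightarrow> s2 a = s1 a"
      have q: "orc (R + j) {j. s2 query j \<noteq> 0} = orc (R + j) (col m j)"
        using orc_col[OF j, of "{j. s2 query j \<noteq> 0}"] s2 *(2) by simp
      have R: "s2 0 (Suc 0) = R" using s2(2)[of 0] *(3)[of 0] bounds by simp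
      show "wp orc (Cond (Var vok) (Query vok (Const 0) query (Add (Cell 0 (Const 1)) (Var vh))) Skip) 12
        (\<lambda>s'. update s' vh 0 (Suc j) vok 0 \<noteq> 0 \<longleftrightarrow> s vok 0 \<noteq> 0 \<and> (\<forall>h<Suc j. orc (R + h) (col m h))) s2"
        by (rule wp_le, rule wp_Cond, rule wp_Query, rule_tac [2] wp_Skip)
          (use q s2(2) * R in \<open>auto simp: update_def less_Suc_eq\<close>)
    qed (use env1 j *(2) n_pos in auto)
  qed (use bounds I_le loop_time[of 60 84] in \<open>auto simp: update_def\<close>)
qed

section \<open>Greedy realisation of a guess\<close>

lemma wp_mark_homes:
  assumes env: "env m s"
  shows "wp orc mark_homes (60 * n) (\<lambda>s'. \<forall>v<n. s' used v = of_bool (v \<in> homes)) s"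
proof -
  have bounds: "s 0 = A" using env by (simp_all add: env_def)
  have first: "wp orc (For vv 0 0 (Assign used (Var vv) (Const 0))) (n * (4 + 12) + 9) (\<lambda>s'. \<forall>v<n. s' used v = 0) s"
  proof (rule wp_conseq[OF wp_For[where T = 4 and M = n and N = n and P = "\<lambda>j s'. \<forall>v<j. s' used v = 0"]])
    fix j :: nat and r
    assume *: "r vv 0 = j" "\<forall>v<j. r used v = 0"
    show "wp orc (Assign used (Var vv) (Const 0)) 4
        (\<lambda>r'. \<forall>v<Suc j. update r' vv 0 (Suc j) used v = 0) r"
      by (rule wp_le, rule wp_Assign) (use * in \<open>auto simp: update_def less_Suc_eq\<close>)
  qed (use bounds A0 in auto)
  have second: "wp orc (For vh 0 2 (Assign used (Cell 0 (Add (Const 3) (Var vh))) (Const 1)))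
      (n * (8 + 12) + 9) (\<lambda>s'. \<forall>v<n. s' used v = of_bool (v \<in> homes)) s1"
    if s1: "\<forall>v<n. s1 used v = 0" "s1 0 = A" for s1
  proof (rule wp_conseq[OF wp_For[where T = 8 and M = n and N = I and
        P = "\<lambda>j s'. \<forall>v<n. s' used v = of_bool (v \<in> (\<lambda>h. A (3 + h)) ` {..<j})"]])
    fix j r
    let ?c = "Assign used (Cell 0 (Add (Const 3) (Var vh))) (Const 1)"
    assume *: "r vh 0 = j" "\<And>x. x \<noteq> vh \<Longrightarrow> x \<notin> writes ?c \<Longrightarrow> r x = s1 x"
      "\<forall>v<n. r used v = of_bool (v \<in> (\<lambda>h. A (3 + h)) ` {..<j})"
    show "wp orc ?c 8 (\<lambda>r'. \<forall>v<n. update r' vh 0 (Suc j) used v =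
        of_bool (v \<in> (\<lambda>h. A (3 + h)) ` {..<Suc j})) r"
      by (rule wp_le, rule wp_Assign) (use * s1 in \<open>auto simp: update_def lessThan_Suc\<close>)
  qed (use s1 A2 I_le in \<open>auto simp: update_def homes_def\<close>)
  show ?thesis
    unfolding mark_homes_def
    by (rule wp_SeqI[OF first second]) (use n_pos bounds in auto)
qed

lemma wp_match_type:
  assumes env: "env m s" and "s vv 0 < n" "s vr 0 < R"
  shows "wp orc match_type (70 * n) (\<lambda>s'. s' vmatch 0 \<noteq> 0 \<longleftrightarrow> ty (s vv 0) = rw m (s vr 0)) s"
proof -
  let ?c = "Cond (Add (Sub guessed adjacent) (Sub adjacent guessed)) (Set vmatch (Const 0)) Skip"
  let ?same = "\<lambda>h. h \<in> ty (s vv 0) \<longleftrightarrow> bit m (s vr 0 * I + h)"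
  have bounds: "s 0 = A" using env by (simp_all add: env_def)
  have loop: "wp orc (For vh 0 2 ?c) (n * (45 + 12) + 9) (\<lambda>s'. s' vmatch 0 \<noteq> 0 \<longleftrightarrow> (\<forall>h<I. ?same h)) s1"
    if s1: "s1 vmatch 0 \<noteq> 0" "\<And>x. x \<noteq> vmatch \<Longrightarrow> s1 x = s x" for s1
  proof (rule wp_conseq[OF wp_For[where T = 45 and M = n and N = I and
        P = "\<lambda>j s'. s' vmatch 0 \<noteq> 0 \<longleftrightarrow> (\<forall>h<j. ?same h)"]])
    fix j r
    assume *: "j < I" "r vh 0 = j" "\<And>x. x \<noteq> vh \<Longrightarrow> x \<notin> writes ?c \<Longrightarrow> r x = s1 x"
      "r vmatch 0 \<noteq> 0 \<longleftrightarrow> (\<forall>h<j. ?same h)"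
    have "env m r" by (rule env_cong[OF env]) (simp_all add: * s1)
    then have e: "eval guessed r = of_bool (bit m (s vr 0 * I + j))" "eval adjacent r = of_bool (j \<in> ty (s vv 0))"
      using eval_guessed[of m r] eval_adjacent[of m r] * s1 assms bounds A2 by auto
    \<comment> \<open>\<open>guessed\<close> and \<open>adjacent\<close> are unfolded only under
      \<open>cost\<close>; inside \<open>eval\<close> they must stay folded for the facts
      \<open>e\<close> to apply.\<close>
    show "wp orc ?c 45 (\<lambda>r'. update r' vh 0 (Suc j) vmatch 0 \<noteq> 0 \<longleftrightarrow> (\<forall>h<Suc j. ?same h)) r"
      by (rule wp_le, rule wp_Cond, rule wp_Assign, rule_tac [2] wp_Skip)
        (use * e in \<open>auto simp: update_def less_Suc_eq guessed_def[THEN arg_cong[of _ _ cost]]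
          adjacent_def[THEN arg_cong[of _ _ cost]] split: if_splits\<close>)
  qed (use s1 bounds A2 I_le in \<open>auto simp: update_def\<close>)
  have "ty (s vv 0) = rw m (s vr 0) \<longleftrightarrow> (\<forall>h<I. ?same h)"
    by (auto simp: ty_def rw_def)
  then show ?thesis
    unfolding match_type_def
    by (simp only:, intro wp_le[OF wp_Seq[OF wp_Assign[OF loop]]]) (use n_pos in \<open>auto simp: update_def\<close>)
qed

text \<open>The failure branch records that no free vertex of the guessed type exists, which is what
  \<open>placement_stuck\<close> needs to refute every placement.\<close>

lemma wp_place_one:
  assumes env: "env m s" and "s vr 0 < R"
  shows "wp orc place_one (130 * (n * n)) (\<lambda>s'.
    if s' vplaced 0 \<noteq> 0
    then \<exists>v<n. s used v = 0 \<and> ty v = rw m (s vr 0) \<and> s' used = (s used)(v := 1)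
    else s' used = s used \<and> (\<forall>v<n. s used v \<noteq> 0 \<or> ty v \<noteq> rw m (s vr 0))) s"
proof -
  let ?c = "Cond (Add (Var vplaced) (Cell used (Var vv))) Skip
      (Seq match_type
        (Cond (Var vmatch) (Seq (Assign used (Var vv) (Const 1)) (Set vplaced (Const 1))) Skip))"
  let ?P = "\<lambda>j s'. if s' vplaced 0 \<noteq> 0
    then \<exists>v<n. s used v = 0 \<and> ty v = rw m (s vr 0) \<and> s' used = (s used)(v := 1)
    else s' used = s used \<and> (\<forall>v<j. s used v \<noteq> 0 \<or> ty v \<noteq> rw m (s vr 0))"
  have bounds: "s 0 0 = n" using env A0 by (simp add: env_def)
  have w: "writes match_type = {vmatch, vh}" by (auto simp: match_type_def)
  have loop: "wp orc (For vv 0 0 ?c) (n * (100 * n + 12) + 9) (?P n) s1"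
    if s1: "s1 vplaced 0 = 0" "\<And>x. x \<noteq> vplaced \<Longrightarrow> s1 x = s x" for s1
  proof (rule wp_conseq[OF wp_For[where T = "100 * n" and M = n and N = n and P = ?P]])
    fix j r
    assume *: "j < n" "r vv 0 = j" "\<And>x. x \<noteq> vv \<Longrightarrow> x \<notin> writes ?c \<Longrightarrow> r x = s1 x" "?P j r"
    have env1: "env m r" by (rule env_cong[OF env]) (simp_all add: * s1 w)
    have j: "j < n" using * s1 bounds by simp
    have r: "r vr = s vr" using * s1 by (simp add: w)
    show "wp orc ?c (100 * n) (\<lambda>r'. ?P (Suc j) (update r' vv 0 (Suc j))) r"
    proof (rule wp_le, rule wp_Cond)
      assume "eval (Add (Var vplaced) (Cell used (Var vv))) r \<noteq> 0"
      then show "wp orc Skip 1 (\<lambda>r'. ?P (Suc j) (update r' vv 0 (Suc j))) r"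
        using * by (intro wp_Skip) (auto simp: update_def less_Suc_eq split: if_splits)
    next
      assume **: "eval (Add (Var vplaced) (Cell used (Var vv))) r = 0"
      show "wp orc (Seq match_type
        (Cond (Var vmatch) (Seq (Assign used (Var vv) (Const 1)) (Set vplaced (Const 1))) Skip)) (70 * n + 13)
        (\<lambda>r'. ?P (Suc j) (update r' vv 0 (Suc j))) r"
      proof (rule wp_Seq, rule wp_conseq[OF wp_match_type[OF env1] order_refl])
        fix r'
        assume r': "r' vmatch 0 \<noteq> 0 \<longleftrightarrow> ty (r vv 0) = rw m (r vr 0)"
          "\<And>a. a \<notin> writes match_type \<Longrightarrow> r' a = r a"
        show "wp orc (Cond (Var vmatch) (Seq (Assign used (Var vv) (Const 1)) (Set vplaced (Const 1))) Skip) 13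
          (\<lambda>r'. ?P (Suc j) (update r' vv 0 (Suc j))) r'"
          by (rule wp_le, rule wp_Cond, rule wp_Seq, rule wp_Assign, rule wp_Assign, rule_tac [2] wp_Skip)
            (use * ** r r' j w in \<open>auto simp: update_def less_Suc_eq split: if_splits\<close>)
      qed (use * j r assms in auto)
    qed (use n_pos in auto)
  qed (use s1 bounds w in \<open>auto simp: update_def\<close>)
  show ?thesis
    unfolding place_one_def
    by (rule wp_le[OF wp_Seq[OF wp_Assign[OF loop]]]) (use loop_time[of 100 130] n_pos in \<open>auto simp: update_def\<close>)
qed

text \<open>
  Greedy placement never fails on a feasible guess: the vertices of the type guessed for \<open>k\<close> would all be taken by
  earlier refugees with that guess, which leaves too few of them for the placement \<open>\<rho>\<close>.
\<close>

lemma placement_stuck: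
  assumes full: "placement m R \<rho>" and part: "placement m k \<pi>" and k: "k < R"
    and stuck: "\<And>v. v < n \<Longrightarrow> ty v = rw m k \<Longrightarrow> v \<in> homes \<or> v \<in> \<pi> ` {..<k}"
  shows False
proof -
  define X where "X = {v. v < n \<and> v \<notin> homes \<and> ty v = rw m k}"
  define Y where "Y j = {i. i < j \<and> rw m i = rw m k}" for j
  have fin: "finite (Y j)" for j by (simp add: Y_def)
  have "card (Y R) \<le> card X"
  proof (rule card_inj_on_le)
    show "inj_on \<rho> (Y R)" using full by (auto simp: placement_def Y_def intro: inj_on_subset)
  qed (use full in \<open>auto simp: placement_def X_def Y_def\<close>)
  \<comment> \<open>An occupied vertex of the type guessed for \<open>k\<close> belongs to an
    earlier refugee whose guess equals that of \<open>k\<close>, because \<open>\<pi>\<close>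
    realises the guesses exactly.\<close>
  also have "X \<subseteq> \<pi> ` Y k"
    using part stuck by (fastforce simp: X_def Y_def placement_def)
  then have "card X \<le> card (Y k)"
    using surj_card_le fin by blast
  \<comment> \<open>\<open>k\<close> itself lies in \<open>Y R\<close> but not in
    \<open>Y k\<close>, which gives the strict inequality.\<close>
  also have "Y k \<subset> Y R" using k by (auto simp: Y_def)
  then have "card (Y k) < card (Y R)" using fin by (rule psubset_card_mono[rotated])
  finally show False by simp
qed

lemma writes_place_one: "writes place_one = {vplaced, vv, used, vmatch, vh}"
  by (auto simp: place_one_def match_type_def)

lemma wp_place_all:
  assumes env: "env m s"
  shows "wp orc place_all (300 * (n * (n * n)))
    (\<lambda>s'. s' vok 0 \<noteq> 0 \<longleftrightarrow> s vok 0 \<noteq> 0 \<and> (\<exists>\<pi>. placement m R \<pi>)) s"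
proof -
  let ?c = "Seq place_one (Cond (Var vplaced) Skip (Set vok (Const 0)))"
  let ?occ = "\<lambda>(s' :: state) (\<pi> :: nat \<Rightarrow> nat) j. \<forall>v<n. s' used v = of_bool (v \<in> homes \<or> v \<in> \<pi> ` {..<j})"
  \<comment> \<open>While \<open>vok\<close> survives, \<open>used\<close> describes exactly the
    homes and the current partial placement. After a failure the invariant excludes all full
    placements, not just extensions of the greedy one.\<close>
  let ?P = "\<lambda>j s'. if s' vok 0 \<noteq> 0 then s vok 0 \<noteq> 0 \<and> (\<exists>\<pi>. placement m j \<pi> \<and> ?occ s' \<pi> j)
    else s vok 0 = 0 \<or> (\<forall>\<pi>. \<not> placement m R \<pi>)"
  have bounds: "s 0 (Suc 0) = R" using env A1 by (simp add: env_def)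
  have loop: "wp orc (For vr 0 1 ?c) (n * (140 * (n * n) + 12) + 9)
      (\<lambda>s'. s' vok 0 \<noteq> 0 \<longleftrightarrow> s vok 0 \<noteq> 0 \<and> (\<exists>\<pi>. placement m R \<pi>)) s1"
    if s1: "\<forall>v<n. s1 used v = of_bool (v \<in> homes)" "\<And>x. x \<notin> writes mark_homes \<Longrightarrow> s1 x = s x" for s1
  proof (rule wp_conseq[OF wp_For[where T = "140 * (n * n)" and M = n and N = R and P = ?P]])
    \<comment> \<open>The constant function is a dummy: no refugee has been placed yet.\<close>
    have "?occ s1 (\<lambda>_. 0) 0" "placement m 0 (\<lambda>_. 0)" using s1(1) by (simp_all add: placement_def)
    then show "?P 0 (update s1 vr 0 0)"
      using s1(2)[of vok] by (auto simp: update_def mark_homes_def)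
  next
    fix j r
    assume *: "j < R" "r vr 0 = j" "\<And>x. x \<noteq> vr \<Longrightarrow> x \<notin> writes ?c \<Longrightarrow> r x = s1 x" "?P j r"
    have env1: "env m r"
      by (rule env_cong[OF env]) (simp_all add: * s1 writes_place_one mark_homes_def)
    show "wp orc ?c (140 * (n * n)) (\<lambda>r'. ?P (Suc j) (update r' vr 0 (Suc j))) r"
    proof (rule wp_SeqI[OF wp_place_one[OF env1], where T' = 7])
      fix r'
      assume r': "if r' vplaced 0 \<noteq> 0
          then \<exists>v<n. r used v = 0 \<and> ty v = rw m (r vr 0) \<and> r' used = (r used)(v := 1)
          else r' used = r used \<and> (\<forall>v<n. r used v \<noteq> 0 \<or> ty v \<noteq> rw m (r vr 0))"
        "\<And>a. a \<notin> writes place_one \<Longrightarrow> r' a = r a"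
      have ok: "r' vok = r vok" using r'(2) by (simp add: writes_place_one)
      have fits: "\<exists>\<pi>. placement m (Suc j) \<pi> \<and> ?occ r' \<pi> (Suc j)"
        if placed: "r' vplaced 0 \<noteq> 0" and alive: "r vok 0 \<noteq> 0"
      proof -
        obtain \<pi> where \<pi>: "placement m j \<pi>" "?occ r \<pi> j" using alive *(4) by (auto split: if_splits)
        obtain v where v: "v < n" "r used v = 0" "ty v = rw m j" "r' used = (r used)(v := 1)"
          using r'(1) placed *(2) by auto
        have eq: "(\<pi>(j := v)) ` {..<Suc j} = insert v (\<pi> ` {..<j})" by (auto simp: lessThan_Suc)
        have "v \<notin> homes" "v \<notin> \<pi> ` {..<j}" using v \<pi>(2) by auto
        then have "placement m (Suc j) (\<pi>(j := v))"
          using \<pi>(1) v by (auto simp: placement_def less_Suc_eq lessThan_Suc inj_on_def)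
        moreover have "?occ r' (\<pi>(j := v)) (Suc j)"
          unfolding eq using \<pi>(2) v by auto
        ultimately show ?thesis by blast
      qed
      have fails: "\<not> placement m R \<rho>" if placed: "r' vplaced 0 = 0" and alive: "r vok 0 \<noteq> 0" for \<rho>
      proof
        assume \<rho>: "placement m R \<rho>"
        obtain \<pi> where \<pi>: "placement m j \<pi>" "?occ r \<pi> j" using alive *(4) by (auto split: if_splits)
        show False
          by (rule placement_stuck[OF \<rho> \<pi>(1) *(1)]) (use \<pi>(2) r'(1) placed *(2) in auto)
      qed
      show "wp orc (Cond (Var vplaced) Skip (Set vok (Const 0))) 7
        (\<lambda>r'. ?P (Suc j) (update r' vr 0 (Suc j))) r'"
      proof (rule wp_le, rule wp_Cond)
        assume "eval (Var vplaced) r' \<noteq> 0"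
        then show "wp orc Skip 1 (\<lambda>r'. ?P (Suc j) (update r' vr 0 (Suc j))) r'"
          using fits *(4) ok by (intro wp_Skip) (simp add: update_def split: if_splits)
      next
        assume "eval (Var vplaced) r' = 0"
        then show "wp orc (Set vok (Const 0)) (1 + cost (Const 0) + cost (Const 0))
          (\<lambda>r'. ?P (Suc j) (update r' vr 0 (Suc j))) r'"
          using fails *(4) ok by (intro wp_Assign) (auto simp: update_def split: if_splits)
      qed simp
    next
      have "1 \<le> n * n" using n_pos by (simp add: Suc_leI)
      then show "130 * (n * n) + 7 \<le> 140 * (n * n)" by linarith
    qed (use *(1,2) in simp)
  next
    fix s'
    assume "?P R s'"
    then show "s' vok 0 \<noteq> 0 \<longleftrightarrow> s vok 0 \<noteq> 0 \<and> (\<exists>\<pi>. placement m R \<pi>)"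
      by (auto split: if_splits)
  qed (use s1(2) bounds R_le in \<open>simp_all add: writes_place_one mark_homes_def\<close>)
  have "60 * n + (n * (140 * (n * n) + 12) + 9) \<le> 300 * (n * (n * n))"
    using powers_le unfolding distrib_left mult.left_commute[of n 140] by linarith
  then show ?thesis
    unfolding place_all_def by (intro wp_SeqI[OF wp_mark_homes[OF env] loop])
qed

lemma writes_check: "writes check = {vok, vr, vh, query, used, vplaced, vv, vmatch}"
  by (auto simp: check_def check_rows_def check_cols_def place_all_def writes_place_one mark_homes_def)

text \<open>Each of the three tests ends with \<open>vok\<close> nonzero iff it was so before and
  the test's own condition holds, so running them in sequence yields the conjunction
  \<open>good m\<close>.\<close>

lemma wp_check:
  assumes env: "env m s"
  shows "wp orc check (500 * (n * (n * n))) (\<lambda>s'. s' vok 0 \<noteq> 0 \<longleftrightarrow> good m) s"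
proof -
  let ?s = "update s vok 0 1"
  have env0: "env m ?s" by (rule env_cong[OF env]) (simp_all add: update_def)
  have cong: "env m s'" if "env m s0" "\<And>a. a \<notin> writes check \<Longrightarrow> s' a = s0 a" for s0 s'
    by (rule env_cong[OF that(1)]) (simp_all add: that(2) writes_check)
  have sub: "writes check_rows \<subseteq> writes check" "writes check_cols \<subseteq> writes check"
    by (auto simp: check_def)
  have "wp orc (Seq check_rows (Seq check_cols place_all)) (490 * (n * (n * n)))
    (\<lambda>s'. s' vok 0 \<noteq> 0 \<longleftrightarrow> good m) ?s"
  proof (rule wp_SeqI[OF wp_check_rows[OF env0]], rule wp_SeqI[OF wp_check_cols, where U = "400 * (n * (n * n))"])
    fix s1
    assume s1: "\<And>a. a \<notin> writes check_rows \<Longrightarrow> s1 a = ?s a"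
      "s1 vok 0 \<noteq> 0 \<longleftrightarrow> ?s vok 0 \<noteq> 0 \<and> (\<forall>r<R. orc r (rw m r))"
    show env1: "env m s1" by (rule cong[OF env0]) (use s1(1) sub in auto)
    fix s2
    assume s2: "\<And>a. a \<notin> writes check_cols \<Longrightarrow> s2 a = s1 a"
      "s2 vok 0 \<noteq> 0 \<longleftrightarrow> s1 vok 0 \<noteq> 0 \<and> (\<forall>h<I. orc (R + h) (col m h))"
    have "env m s2" by (rule cong[OF env1]) (use s2(1) sub in auto)
    from wp_place_all[OF this] show "wp orc place_all (300 * (n * (n * n)))
      (\<lambda>s'. s' vok 0 \<noteq> 0 \<longleftrightarrow> good m) s2"
      by (rule wp_conseq) (use s1(2) s2(2) in \<open>auto simp: good_def update_def\<close>)
  qed (use powers_le in linarith)+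
  moreover have "3 + 490 * (n * (n * n)) \<le> 500 * (n * (n * n))" using powers_le by linarith
  ultimately show ?thesis
    unfolding check_def by (intro wp_le[OF wp_Seq[OF wp_Assign]]) auto
qed

section \<open>Enumerating all guesses\<close>

lemma wp_increment:
  assumes env: "env m s" and len: "s vlen 0 = R * I"
  shows "wp orc increment (100 * (n * n)) (env (Suc m)) s"
proof -
  let ?c = "Cond (Var vcarry)
      (Cond (Cell bits (Var vj)) (Assign bits (Var vj) (Const 0))
        (Seq (Assign bits (Var vj) (Const 1)) (Set vcarry (Const 0)))) Skip"
  \<comment> \<open>Positions below \<open>j\<close> already show \<open>Suc m\<close>, the others
    still \<open>m\<close>. The initial carry 1 fits \<open>2 ^ 0 dvd Suc m\<close>. A carry out of
    the last position is dropped, which is sound since \<open>env\<close> looks only at bits below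
    \<open>R * I\<close>.\<close>
  let ?P = "\<lambda>j s'. (\<forall>i<R*I. s' bits i = of_bool (bit (if i < j then Suc m else m) i)) \<and>
    s' vcarry 0 = of_bool (2 ^ j dvd Suc m)"
  have le: "R * I \<le> n * n" using R_le I_le by (rule mult_le_mono)
  have loop: "wp orc (For vj vlen 0 ?c) (n * n * (30 + 12) + 9) (env (Suc m)) s1"
    if s1: "s1 = update s vcarry 0 1" for s1
  proof (rule wp_conseq[OF wp_For[where T = 30 and M = "n * n" and N = "R * I" and P = ?P]])
    fix j r
    assume *: "j < R * I" "r vj 0 = j" "?P j r"
    show "wp orc ?c 30 (\<lambda>r'. ?P (Suc j) (update r' vj 0 (Suc j))) r"
      by (rule wp_le, rule wp_Cond, rule wp_Cond, rule wp_Assign, rule_tac [2] wp_Seq,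
          rule_tac [2] wp_Assign, rule_tac [2] wp_Assign, rule_tac [3] wp_Skip)
        (use * in \<open>auto simp: update_def less_Suc_eq bit_Suc_iff_dvd dvd_power_Suc_iff_bit
          simp del: power_Suc split: if_splits\<close>)
  next
    fix s'
    assume s': "?P (R * I) s'" "\<And>a. a \<notin> writes (For vj vlen 0 ?c) \<Longrightarrow> s' a = s1 a"
    have "s' 0 = s 0" "s' row = s row" "s' base = s base"
      using s'(2) s1 by (simp_all add: update_def)
    then show "env (Suc m) s'"
      using s'(1) env by (simp add: env_def)
  qed (use s1 len le env in \<open>auto simp: update_def env_def\<close>)
  have "1 \<le> n * n" using n_pos by (simp add: Suc_leI)
  then have "3 + (n * n * 42 + 9) \<le> 100 * (n * n)" by linarith
  then show ?thesis
    unfolding increment_def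
    by (intro wp_le[OF wp_Seq[OF wp_Assign[OF loop]]]) auto
qed

lemma writes_increment: "writes increment = {vcarry, vj, bits}"
  by (auto simp: increment_def)

text \<open>The counter \<open>vm\<close> only drives the loop; the guess itself lives in
  \<open>bits\<close>, and the invariant ties both to the same \<open>j\<close>. Per guess, 500 for
  \<open>check\<close>, 100 for \<open>increment\<close> and 8 for recording success give the
  608.\<close>

lemma wp_search:
  assumes env: "env 0 s" and len: "s vlen 0 = R * I" and pow: "s vpow 0 = 2 ^ (R * I)"
    and found: "s vfound 0 = 0"
  shows "wp orc search (2 ^ (R * I) * (640 * (n * (n * n))))
    (\<lambda>s'. s' vfound 0 \<noteq> 0 \<longleftrightarrow> (\<exists>m < 2 ^ (R * I). good m)) s"
  unfolding search_def
proof (rule wp_conseq[OF wp_For[where T = "608 * (n * (n * n))" and M = "2 ^ (R * I)" and N = "2 ^ (R * I)" and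
        P = "\<lambda>j s'. env j s' \<and> (s' vfound 0 \<noteq> 0 \<longleftrightarrow> (\<exists>m<j. good m))"]])
  let ?c = "Seq check (Seq (Cond (Var vok) (Set vfound (Const 1)) Skip) increment)"
  fix j r
  assume *: "j < 2 ^ (R * I)" "\<And>x. x \<noteq> vm \<Longrightarrow> x \<notin> writes ?c \<Longrightarrow> r x = s x"
    "env j r \<and> (r vfound 0 \<noteq> 0 \<longleftrightarrow> (\<exists>m<j. good m))"
  let ?Q = "\<lambda>r'. env (Suc j) (update r' vm 0 (Suc j)) \<and>
      (update r' vm 0 (Suc j) vfound 0 \<noteq> 0 \<longleftrightarrow> (\<exists>m<Suc j. good m))"
  show "wp orc ?c (608 * (n * (n * n))) ?Q r"
  proof (rule wp_SeqI[OF wp_check])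
    show "env j r" using * by simp
    fix s1
    assume s1: "s1 vok 0 \<noteq> 0 \<longleftrightarrow> good j" "\<And>a. a \<notin> writes check \<Longrightarrow> s1 a = r a"
    have finish: "wp orc increment (100 * (n * n)) ?Q s2"
      if s2: "\<And>x. x \<noteq> vfound \<Longrightarrow> s2 x = s1 x" "s2 vfound 0 \<noteq> 0 \<longleftrightarrow> (\<exists>m<Suc j. good m)" for s2
    proof (rule wp_conseq[OF wp_increment order_refl])
      show "env j s2" by (rule env_cong[of j r]) (use * s1 s2 in \<open>auto simp: writes_check\<close>)
      show "s2 vlen 0 = R * I" using len * s1 s2 by (simp add: writes_check writes_increment)
      fix s3
      assume s3: "env (Suc j) s3" "\<And>a. a \<notin> writes increment \<Longrightarrow> s3 a = s2 a"
      have "env (Suc j) (update s3 vm 0 (Suc j))" by (rule env_cong[OF s3(1)]) (simp_all add: update_def)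
      then show "?Q s3" using s2(2) s3(2)[of vfound] by (simp add: update_def writes_increment)
    qed
    have f1: "s1 vfound 0 \<noteq> 0 \<longleftrightarrow> (\<exists>m<j. good m)" using * s1(2) by (simp add: writes_check)
    show "wp orc (Seq (Cond (Var vok) (Set vfound (Const 1)) Skip) increment) (8 + 100 * (n * n)) ?Q s1"
      by (rule wp_le, rule wp_Seq, rule wp_Cond, rule wp_Assign, rule finish, rule_tac [3] wp_Skip,
          rule_tac [3] finish)
        (use s1(1) f1 in \<open>auto simp: update_def less_Suc_eq\<close>)
  qed (use powers_le in linarith)
next
  have "(1::nat) \<le> 2 ^ (R * I)" by simp
  moreover have "(2::nat) ^ (R * I) \<le> 2 ^ (R * I) * (n * (n * n))" using powers_le(1) by simp
  ultimately show "2 ^ (R * I) * (608 * (n * (n * n)) + 12) + 9 \<le> 2 ^ (R * I) * (640 * (n * (n * n)))"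
    unfolding distrib_left mult.left_commute[of "2 ^ (R * I)" "numeral _"] by linarith
qed (use pow found env in \<open>auto simp: writes_check writes_increment update_def intro: env_cong\<close>)

section \<open>Tables and the complete program\<close>

lemma wp_setup_rows:
  assumes "s 0 = A" "s row 0 = 0"
  shows "wp orc setup_rows (60 * n) (\<lambda>s'. \<forall>r\<le>R. s' row r = r * I) s"
  unfolding setup_rows_def
proof (rule wp_conseq[OF wp_For[where T = 20 and M = n and N = R and P = "\<lambda>j s'. \<forall>r\<le>j. s' row r = r * I"]])
  let ?c = "Assign row (Add (Var vr) (Const 1)) (Add (Cell row (Var vr)) (Cell 0 (Const 2)))"
  fix j r
  assume *: "r vr 0 = j" "\<And>x. x \<noteq> vr \<Longrightarrow> x \<notin> writes ?c \<Longrightarrow> r x = s x" "\<forall>i\<le>j. r row i = i * I"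
  show "wp orc ?c 20 (\<lambda>r'. \<forall>i\<le>Suc j. update r' vr 0 (Suc j) row i = i * I) r"
    by (rule wp_le, rule wp_Assign) (use * assms A2 in \<open>auto simp: update_def le_Suc_eq\<close>)
qed (use assms A1 R_le n_pos in \<open>auto simp: update_def\<close>)

lemma wp_setup_base:
  assumes "s 0 = A"
  shows "wp orc setup_base (80 * n) (\<lambda>s'. \<forall>v\<le>n. s' base v = 3 + I + v * n) s"
proof -
  let ?c = "Assign base (Add (Var vv) (Const 1)) (Add (Cell base (Var vv)) (Cell 0 (Const 0)))"
  have loop: "wp orc (For vv 0 0 ?c) (n * (20 + 12) + 9) (\<lambda>s'. \<forall>v\<le>n. s' base v = 3 + I + v * n) s1"
    if s1: "s1 base 0 = 3 + I" "s1 0 = A" for s1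
  proof (rule wp_conseq[OF wp_For[where T = 20 and M = n and N = n and
        P = "\<lambda>j s'. \<forall>v\<le>j. s' base v = 3 + I + v * n"]])
    fix j r
    assume *: "r vv 0 = j" "\<And>x. x \<noteq> vv \<Longrightarrow> x \<notin> writes ?c \<Longrightarrow> r x = s1 x"
      "\<forall>v\<le>j. r base v = 3 + I + v * n"
    show "wp orc ?c 20 (\<lambda>r'. \<forall>v\<le>Suc j. update r' vv 0 (Suc j) base v = 3 + I + v * n) r"
      by (rule wp_le, rule wp_Assign) (use * s1 A0 in \<open>auto simp: update_def le_Suc_eq\<close>)
  qed (use s1 A0 in \<open>auto simp: update_def\<close>)
  show ?thesis
    unfolding setup_base_def
    by (rule wp_le[OF wp_Seq[OF wp_Assign[OF loop]]]) (use assms A2 n_pos in \<open>auto simp: update_def\<close>)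
qed

lemma wp_setup_pow:
  assumes "s 0 = A" "s row R = R * I"
  shows "wp orc setup_pow (80 * (n * n)) (\<lambda>s'. s' vlen 0 = R * I \<and> s' vpow 0 = 2 ^ (R * I)) s"
proof -
  let ?c = "Set vpow (Add (Var vpow) (Var vpow))"
  have le: "R * I \<le> n * n" using R_le I_le by (rule mult_le_mono)
  have loop: "wp orc (For vj vlen 0 ?c) (n * n * (10 + 12) + 9)
      (\<lambda>s'. s' vlen 0 = R * I \<and> s' vpow 0 = 2 ^ (R * I)) s1"
    if s1: "s1 vlen 0 = R * I" "s1 vpow 0 = 1" for s1
  proof (rule wp_conseq[OF wp_For[where T = 10 and M = "n * n" and N = "R * I" and P = "\<lambda>j s'. s' vpow 0 = 2 ^ j"]])
    fix j and r :: state
    assume "r vpow 0 = 2 ^ j"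
    then show "wp orc ?c 10 (\<lambda>r'. update r' vj 0 (Suc j) vpow 0 = 2 ^ Suc j) r"
      by (intro wp_le[OF wp_Assign]) (auto simp: update_def)
  qed (use s1 le in \<open>auto simp: update_def\<close>)
  have "1 \<le> n * n" using n_pos by (simp add: Suc_leI)
  then have "9 + (n * n * 22 + 9) \<le> 80 * (n * n)" by linarith
  then show ?thesis
    unfolding setup_pow_def
    by (intro wp_le[OF wp_Seq[OF wp_Assign[OF wp_Seq[OF wp_Assign[OF loop]]]]])
      (use assms A1 in \<open>auto simp: update_def\<close>)
qed

text \<open>Memory outside the input being zero provides the first guess 0, the entry
  \<open>row 0\<close> and the cleared \<open>vfound\<close>.\<close>

lemma wp_solve:
  assumes s: "s 0 = A" "\<And>a i. a \<noteq> 0 \<Longrightarrow> s a i = 0"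
  shows "wp orc solve (1000 * 2 ^ (R * I) * (n * (n * n)))
    (\<lambda>s'. s' 0 0 = (if \<exists>m < 2 ^ (R * I). good m then 1 else 0)) s"
proof -
  \<comment> \<open>\<open>X\<close> dominates 1, \<open>n\<close>, \<open>n * n\<close> and
    \<open>n * (n * n)\<close>, so all remaining time estimates are linear in
    \<open>X\<close>.\<close>
  define X where "X = (2::nat) ^ (R * I) * (n * (n * n))"
  have "n * (n * n) \<le> X" by (simp add: X_def)
  then have le: "n \<le> X" "n * n \<le> X" "n * (n * n) \<le> X" "1 \<le> X"
    using powers_le by linarith+
  have search_time: "2 ^ (R * I) * (640 * (n * (n * n))) = 640 * X" by (simp add: X_def)
  let ?Q = "\<lambda>s'. s' 0 0 = (if \<exists>m < 2 ^ (R * I). good m then 1 else 0)"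
  let ?out = "Cond (Var vfound) (Set 0 (Const 1)) (Set 0 (Const 0))"
  have "wp orc solve (1000 * X) ?Q s"
    unfolding solve_def
  proof (rule wp_SeqI[OF wp_setup_rows, where T' = "900 * X"],
      goal_cases)
    case (3 s1)
    then have s1: "s1 0 = A" "\<forall>r\<le>R. s1 row r = r * I" "s1 bits = s bits" "s1 vfound = s vfound"
      using s by (simp_all add: setup_rows_def)
    show ?case
    proof (rule wp_SeqI[OF wp_setup_base, where T' = "800 * X"], goal_cases)
      case (2 s2)
      then have s2: "s2 0 = A" "\<forall>r\<le>R. s2 row r = r * I" "\<forall>v\<le>n. s2 base v = 3 + I + v * n"
        "s2 bits = s bits" "s2 vfound = s vfound"
        using s1 by (simp_all add: setup_base_def)
      show ?case
      proof (rule wp_SeqI[OF wp_setup_pow, where T' = "700 * X"], goal_cases)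
        case (3 s3)
        then have s3: "s3 0 = A" "s3 row = s2 row" "s3 base = s2 base" "s3 bits = s bits" "s3 vfound = s vfound"
          using s2 by (simp_all add: setup_pow_def)
        have "env 0 s3" using s s2 s3 by (simp add: env_def)
        moreover have "s3 vfound 0 = 0" using s s3 by simp
        ultimately have "wp orc search (640 * X)
            (\<lambda>s'. s' vfound 0 \<noteq> 0 \<longleftrightarrow> (\<exists>m < 2 ^ (R * I). good m)) s3"
          using wp_search[of s3] 3 search_time by simp
        then show ?case
        proof (rule wp_SeqI[where T' = 11])
          fix s4 :: state
          assume "s4 vfound 0 \<noteq> 0 \<longleftrightarrow> (\<exists>m < 2 ^ (R * I). good m)"
          then show "wp orc ?out 11 ?Q s4"
            by (intro wp_le[OF wp_Cond[OF wp_Assign wp_Assign]]) (auto simp: update_def)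
        qed (use le in linarith)
      qed (use s2 le in \<open>auto\<close>)
    qed (use s1 le in \<open>auto\<close>)
  qed (use s le in \<open>auto\<close>)
  then show ?thesis by (simp add: X_def mult.assoc)
qed

end

section \<open>Encoded instances\<close>

text \<open>Row-major indexing, used both for the adjacency matrix in the word and for the bit
  matrix of a guess.\<close>

lemma nth_concat_map_uniform:
  assumes "i < length xs" "j < length ys"
  shows "concat (map (\<lambda>u. map (f u) ys) xs) ! (i * length ys + j) = f (xs ! i) (ys ! j)"
  using assms(1)
proof (induction xs arbitrary: i)
  case (Cons x xs)
  then show ?case
    using assms(2) by (cases i) (auto simp: nth_append)
qed simp

text \<open>Every adjacency pattern is among the enumerated guesses: the concatenated rows are read
  as binary digits, least significant first.\<close>

lemma ex_bit_matrix: "\<exists>m < (2::nat) ^ (R * I). \<forall>r<R. \<forall>h<I. bit m (r * I + h) \<longleftrightarrow> P r h"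
proof -
  let ?bs = "concat (map (\<lambda>r. map (P r) [0..<I]) [0..<R])"
  have len: "length ?bs = R * I" by (simp add: length_concat o_def sum_list_triv)
  have "bit (horner_sum of_bool 2 ?bs :: nat) (r * I + h) \<longleftrightarrow> P r h" if "r < R" "h < I" for r h
  proof -
    show ?thesis
      using nth_concat_map_uniform[of r "[0..<R]" h "[0..<I]" P] index_less[OF that] that len
      by (simp add: bit_horner_sum_bit_iff)
  qed
  moreover have "(horner_sum of_bool 2 ?bs :: nat) < 2 ^ (R * I)"
    using horner_sum_of_bool_2_less[of ?bs] unfolding len by simp
  ultimately show ?thesis by blast
qed

locale encoded_hrh =
  fixes x :: "('v, 'r, 'h) hrh" and vs rs hs ps
  assumes inst: "hrh_instance x"
    and vs: "distinct vs" "set vs = verts x"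
    and rs: "distinct rs" "set rs = refugees x"
    and hs: "distinct hs" "set hs = inhabitants x"
    and ps: "set ps \<subseteq> {..<length vs}" "map ((!) vs) ps = map (home x) hs"
begin

definition "word = [length vs, length rs, length hs] @ ps @
  [if {u, v} \<in> edges x then 1 else 0. u \<leftarrow> vs, v \<leftarrow> vs]"

lemma length_ps: "length ps = length hs"
  using ps(2) by (rule map_eq_imp_length_eq)

lemma ps_nth: "h < length hs \<Longrightarrow> ps ! h < length vs \<and> vs ! (ps ! h) = home x (hs ! h)"
  using ps length_ps by (metis lessThan_iff nth_map nth_mem subsetD)

lemma word_home: "h < length hs \<Longrightarrow> input word 0 (3 + h) = ps ! h"
  by (simp add: input_def word_def nth_append length_ps)

lemma word_adj:
  assumes "u < length vs" "v < length vs"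
  shows "input word 0 (3 + length hs + u * length vs + v) = of_bool ({vs ! u, vs ! v} \<in> edges x)"
  using index_less[OF assms]
    nth_concat_map_uniform[OF assms, of "\<lambda>u v. if {u, v} \<in> edges x then 1 else (0::nat)"]
  by (simp add: input_def word_def nth_append length_ps length_concat o_def sum_list_triv add.assoc)

sublocale hrh_word "approval_oracle x rs hs" "input word 0" "length vs" "length rs" "length hs"
proof
  have card: "length vs = card (verts x)" "length rs = card (refugees x)" "length hs = card (inhabitants x)"
    using vs rs hs distinct_card by metis+
  then show "length rs \<le> length vs" "length hs \<le> length vs" "0 < length vs"
    using inst by (auto simp: hrh_instance_def card_gt_0_iff)
  show "input word 0 (3 + h) < length vs" if "h < length hs" for h
    using word_home ps_nth that by simp
  show "input word 0 (3 + length hs + v * length vs + input word 0 (3 + h)) \<le> 1"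
    if "v < length vs" "h < length hs" for v h
    using word_home[OF that(2)] ps_nth[OF that(2)] word_adj[OF that(1)] by simp
qed (auto simp: approval_oracle_def input_def word_def intro!: arg_cong2[of _ _ _ _ "(\<in>)"])

lemma ty_eq: "v < length vs \<Longrightarrow> ty v = {h. h < length hs \<and> home x (hs ! h) \<in> nbhd x (vs ! v)}"
  using word_home word_adj ps_nth by (auto simp: ty_def nbhd_def insert_commute)

lemma homes_iff: "v < length vs \<Longrightarrow> v \<in> homes \<longleftrightarrow> vs ! v \<in> home x ` inhabitants x"
proof
  assume v: "v < length vs" "vs ! v \<in> home x ` inhabitants x"
  then obtain h where h: "h < length hs" "vs ! v = home x (hs ! h)"
    unfolding hs(2)[symmetric] by (auto simp: in_set_conv_nth)
  then have "v = ps ! h" using v(1) ps_nth[of h] nth_eq_iff_index_eq[OF vs(1), of v "ps ! h"] by auto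
  then show "v \<in> homes" using h(1) word_home by (auto simp: homes_def)
next
  assume "v \<in> homes"
  then obtain h where "h < length hs" "v = ps ! h" using word_home by (auto simp: homes_def)
  then show "vs ! v \<in> home x ` inhabitants x" using ps_nth hs(2) by auto
qed

text \<open>If \<open>m\<close> records the types of the chosen vertices, row \<open>r\<close> of
  \<open>m\<close> is the neighbourhood seen by refugee \<open>r\<close> and column \<open>h\<close>
  the one seen by inhabitant \<open>h\<close>, so the oracle answers are precisely the approval
  conditions.\<close>

lemma housing_respecting_iff:
  assumes \<pi>: "\<And>i. i < length rs \<Longrightarrow> \<pi> i < length vs \<and> \<rho> (rs ! i) = vs ! \<pi> i"
    and m: "\<And>i. i < length rs \<Longrightarrow> ty (\<pi> i) = rw m i"
  shows "housing x \<rho> \<and> respecting x \<rho> \<longleftrightarrow> placement m (length rs) \<pi> \<and>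
    (\<forall>r<length rs. approval_oracle x rs hs r (rw m r)) \<and>
    (\<forall>h<length hs. approval_oracle x rs hs (length rs + h) (col m h))"
proof -
  have all_rs: "(\<forall>r\<in>refugees x. P r) \<longleftrightarrow> (\<forall>i<length rs. P (rs ! i))" for P
    unfolding rs(2)[symmetric] by (rule all_set_conv_all_nth)
  have all_hs: "(\<forall>h\<in>inhabitants x. P h) \<longleftrightarrow> (\<forall>i<length hs. P (hs ! i))" for P
    unfolding hs(2)[symmetric] by (rule all_set_conv_all_nth)
  have "\<rho> ` refugees x \<subseteq> unoccupied x \<longleftrightarrow> (\<forall>i<length rs. \<pi> i \<notin> homes)"
    unfolding image_subset_iff all_rs
    using \<pi> homes_iff vs(2) by (auto simp: unoccupied_def)
  moreover have "inj_on \<rho> (refugees x) \<longleftrightarrow> inj_on \<pi> {..<length rs}"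
    unfolding inj_on_def all_rs using \<pi> rs(1) vs(1)
    by (simp add: nth_eq_iff_index_eq Ball_def)
  ultimately have housing: "housing x \<rho> \<longleftrightarrow> placement m (length rs) \<pi>"
    using \<pi> m by (auto simp: housing_def placement_def)
  have "approval_oracle x rs hs r (rw m r) \<longleftrightarrow>
      {h \<in> inhabitants x. home x h \<in> nbhd x (\<rho> (rs ! r))} \<in> refugee_approves x (rs ! r)"
    if r: "r < length rs" for r
  proof -
    have "{hs ! j |j. j < length hs \<and> j \<in> rw m r} = {h \<in> inhabitants x. home x h \<in> nbhd x (\<rho> (rs ! r))}"
      using ty_eq[of "\<pi> r"] \<pi>[OF r] unfolding m[OF r] hs(2)[symmetric] by (auto simp: in_set_conv_nth)
    then show ?thesis using r by (simp add: approval_oracle_def)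
  qed
  moreover have "approval_oracle x rs hs (length rs + h) (col m h) \<longleftrightarrow>
      {r \<in> refugees x. \<rho> r \<in> nbhd x (home x (hs ! h))} \<in> inhabitant_approves x (hs ! h)"
    if h: "h < length hs" for h
  proof -
    have "j \<in> col m h \<longleftrightarrow> \<rho> (rs ! j) \<in> nbhd x (home x (hs ! h))" if "j < length rs" for j
    proof -
      \<comment> \<open>Rows and columns read the same bit; symmetry of edges then turns the
        refugee's view into the inhabitant's.\<close>
      have "j \<in> col m h \<longleftrightarrow> h \<in> ty (\<pi> j)" using that h m by (simp add: col_def rw_def)
      then show ?thesis
        using ty_eq[of "\<pi> j"] \<pi>[OF that] h by (simp add: nbhd_def insert_commute)
    qed
    then have "{rs ! j |j. j < length rs \<and> j \<in> col m h} = {r \<in> refugees x. \<rho> r \<in> nbhd x (home x (hs ! h))}"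
      unfolding rs(2)[symmetric] by (auto simp: in_set_conv_nth)
    then show ?thesis using h by (simp add: approval_oracle_def)
  qed
  ultimately show ?thesis
    unfolding housing respecting_def all_rs all_hs by auto
qed

lemma ex_good_iff: "(\<exists>m < 2 ^ (length rs * length hs). good m) \<longleftrightarrow> (\<exists>\<rho>. housing x \<rho> \<and> respecting x \<rho>)"
proof
  assume "\<exists>m < 2 ^ (length rs * length hs). good m"
  then obtain m \<pi> where m: "good m" "placement m (length rs) \<pi>" by (auto simp: good_def)
  \<comment> \<open>\<open>\<pi>\<close> works on numbers of refugees and vertices;
    \<open>inv_into\<close> recovers the number of a refugee, uniquely because \<open>rs\<close> is
    distinct.\<close>
  define \<rho> where "\<rho> r = vs ! \<pi> (inv_into {..<length rs} ((!) rs) r)" for r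
  have "inj_on ((!) rs) {..<length rs}" using rs(1) by (simp add: inj_on_nth)
  then have "\<rho> (rs ! i) = vs ! \<pi> i" if "i < length rs" for i
    using that by (simp add: \<rho>_def)
  then have "housing x \<rho> \<and> respecting x \<rho>"
    using m by (subst housing_respecting_iff) (auto simp: good_def placement_def)
  then show "\<exists>\<rho>. housing x \<rho> \<and> respecting x \<rho>" by blast
next
  assume "\<exists>\<rho>. housing x \<rho> \<and> respecting x \<rho>"
  then obtain \<rho> where \<rho>: "housing x \<rho>" "respecting x \<rho>" by blast
  have "\<exists>v < length vs. \<rho> (rs ! i) = vs ! v" if "i < length rs" for i
  proof -
    have "\<rho> (rs ! i) \<in> set vs"
      using \<rho>(1) nth_mem[OF that] unfolding rs(2) vs(2) by (auto simp: housing_def unoccupied_def)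
    then show ?thesis by (auto simp: in_set_conv_nth)
  qed
  then obtain \<pi> where \<pi>: "\<And>i. i < length rs \<Longrightarrow> \<pi> i < length vs \<and> \<rho> (rs ! i) = vs ! \<pi> i"
    by metis
  \<comment> \<open>The successful guess is the actual adjacency pattern of the given
    housing.\<close>
  obtain m :: nat where m: "m < 2 ^ (length rs * length hs)"
      "\<And>r h. r < length rs \<Longrightarrow> h < length hs \<Longrightarrow> bit m (r * length hs + h) \<longleftrightarrow> h \<in> ty (\<pi> r)"
    using ex_bit_matrix[of "length rs" "length hs" "\<lambda>r h. h \<in> ty (\<pi> r)"] by blast
  have "ty (\<pi> i) = rw m i" if "i < length rs" for i
    using m(2)[OF that] by (auto simp: rw_def ty_def)
  then have "good m"
    using housing_respecting_iff[of \<pi> \<rho> m] \<pi> \<rho> by (auto simp: good_def)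
  then show "\<exists>m < 2 ^ (length rs * length hs). good m" using m(1) by blast
qed

lemma solve_outputs:
  "\<exists>t. outputs solve (approval_oracle x rs hs) word t (if \<exists>\<rho>. housing x \<rho> \<and> respecting x \<rho> then 1 else 0) \<and>
    t \<le> 1000 * 2 ^ (length rs * length hs) * length vs ^ 3"
proof -
  have "wp (approval_oracle x rs hs) solve
      (1000 * 2 ^ (length rs * length hs) * (length vs * (length vs * length vs)))
      (\<lambda>s'. s' 0 0 = (if \<exists>m < 2 ^ (length rs * length hs). good m then 1 else 0)) (input word)"
    by (rule wp_solve) (simp_all add: input_def)
  then show ?thesis
    unfolding wp_def outputs_def ex_good_iff power3_eq_cube mult.assoc by blast
qed

end

text \<open>\<open>computable\<close> asks for a program on the same machine, so the bound is
  produced by \<open>k * k\<close> doublings of 1000 in two nested loops.\<close>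

lemma computable_bound: "computable (\<lambda>k. 1000 * 2 ^ (k * k))"
proof -
  let ?in = "Set 4 (Add (Var 4) (Var 4))"
  let ?c = "Seq (Set 4 (Const 1000)) (Seq (For 2 0 0 (For 3 0 0 ?in)) (Set 0 (Var 4)))"
  have "\<exists>t. outputs ?c (\<lambda>_ _. False) [k] t (1000 * 2 ^ (k * k))" for k
  proof -
    let ?o = "\<lambda>_ _. False"
    have inner: "wp ?o (For 3 0 0 ?in) (k * (10 + 12) + 9) (\<lambda>s'. s' 4 0 = 1000 * 2 ^ (Suc j * k)) r"
      if r: "r 0 0 = k" "r 4 0 = 1000 * 2 ^ (j * k)" for j r
    proof (rule wp_conseq[OF wp_For[where T = 10 and M = k and N = k and
          P = "\<lambda>i s'. s' 4 0 = 1000 * 2 ^ (j * k + i)"]])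
      fix i and r' :: state
      assume "r' 4 0 = 1000 * 2 ^ (j * k + i)"
      then show "wp ?o ?in 10 (\<lambda>r'. update r' 3 0 (Suc i) 4 0 = 1000 * 2 ^ (j * k + Suc i)) r'"
        by (intro wp_le[OF wp_Assign]) (auto simp: update_def)
    qed (use r in \<open>auto simp: update_def add.commute\<close>)
    have outer: "wp ?o (For 2 0 0 (For 3 0 0 ?in)) (k * (k * (10 + 12) + 9 + 12) + 9)
        (\<lambda>s'. s' 4 0 = 1000 * 2 ^ (k * k)) r"
      if r: "r 0 0 = k" "r 4 0 = 1000" for r
    proof (rule wp_conseq[OF wp_For[where T = "k * (10 + 12) + 9" and M = k and N = k and
          P = "\<lambda>j s'. s' 4 0 = 1000 * 2 ^ (j * k)"]])
      fix j and r' :: state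
      assume *: "\<And>x. x \<noteq> 2 \<Longrightarrow> x \<notin> writes (For 3 0 0 ?in) \<Longrightarrow> r' x = r x" "r' 4 0 = 1000 * 2 ^ (j * k)"
      show "wp ?o (For 3 0 0 ?in) (k * (10 + 12) + 9)
          (\<lambda>r'. update r' 2 0 (Suc j) 4 0 = 1000 * 2 ^ (Suc j * k)) r'"
        by (rule wp_conseq[OF inner[of r' j]]) (use * r in \<open>auto simp: update_def\<close>)
    qed (use r in \<open>auto simp: update_def\<close>)
    have "wp ?o ?c (4 + ((k * (k * (10 + 12) + 9 + 12) + 9) + 4)) (\<lambda>s'. s' 0 0 = 1000 * 2 ^ (k * k)) (input [k])"
    proof (rule wp_le[OF wp_Seq[OF wp_Assign]], rule wp_SeqI[OF outer])
      fix s' :: state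
      assume "s' 4 0 = 1000 * 2 ^ (k * k)"
      then show "wp ?o (Set 0 (Var 4)) 4 (\<lambda>s'. s' 0 0 = 1000 * 2 ^ (k * k)) s'"
        by (intro wp_le[OF wp_Assign]) (auto simp: update_def)
    qed (auto simp: update_def input_def)
    then show ?thesis
      unfolding wp_def outputs_def by blast
  qed
  then show ?thesis unfolding computable_def by blast
qed

theorem theorem4p7:
  "FPT (hrh_instance :: (nat, nat, nat) hrh \<Rightarrow> bool) hrh_encodes
     (\<lambda>x. card (verts x))
     (\<lambda>x. card (refugees x) + card (inhabitants x))
     (\<lambda>x. \<exists>\<pi>. housing x \<pi> \<and> respecting x \<pi>)"
  unfolding FPT_def
proof (rule exI[of _ solve], rule exI[of _ "\<lambda>k. 1000 * 2 ^ (k * k)"], rule exI[of _ 3],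
    intro conjI allI impI computable_bound)
  fix x :: "(nat, nat, nat) hrh" and w orc
  assume "hrh_instance x" "hrh_encodes x w orc"
  then obtain vs rs hs ps where enc: "encoded_hrh x vs rs hs ps"
      and w: "w = [length vs, length rs, length hs] @ ps @
        [if {u, v} \<in> edges x then 1 else 0. u \<leftarrow> vs, v \<leftarrow> vs]"
      and orc: "orc = approval_oracle x rs hs"
    unfolding hrh_encodes_def encoded_hrh_def by blast
  interpret encoded_hrh x vs rs hs ps by (fact enc)
  have card: "card (verts x) = length vs" "card (refugees x) = length rs" "card (inhabitants x) = length hs"
    using vs rs hs distinct_card by metis+
  let ?k = "card (refugees x) + card (inhabitants x)"
  \<comment> \<open>\<open>f\<close> may depend only on the sum \<open>?k\<close>; both factors are
    at most \<open>?k\<close>.\<close>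
  have "length rs * length hs \<le> ?k * ?k"
    unfolding card by (intro mult_le_mono) simp_all
  then have "(2::nat) ^ (length rs * length hs) \<le> 2 ^ (?k * ?k)" by (simp add: power_increasing)
  then have "1000 * 2 ^ (length rs * length hs) * length vs ^ 3 \<le> 1000 * 2 ^ (?k * ?k) * card (verts x) ^ 3"
    unfolding card(1) by (intro mult_le_mono) simp_all
  then show "\<exists>t. outputs solve orc w t (if \<exists>\<pi>. housing x \<pi> \<and> respecting x \<pi> then 1 else 0) \<and>
      t \<le> 1000 * 2 ^ (?k * ?k) * card (verts x) ^ 3"
    unfolding w orc word_def[symmetric] using solve_outputs le_trans by blast
qed

end
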